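(* Let $d=2$, $k=\lceil \theta/2\rceil>1$ and $p=a\,n^{-1-1/k}$, where $a>0$ is a constant. Then, as $n\to\infty$, $$\mathbb{P}_p(\omega_\infty\equiv 1)\to\begin{cases}1-e^{-2a^k/k!}, & \text{if }\theta\text{ is odd},\\ \bigl(1-e^{-a^k/k!}\bigr)^2, & \text{if }\theta\text{ is even}.\end{cases}$$ Thus, $$p_{\mathrm c}(2,2)=p_{\mathrm c}(1,2)=p^*_{\mathrm c}(0,2)=n^{-1-\frac{2}{\theta}+o(\theta^{-3/2})}.$$ Furthermore, $$\mathbb{P}_p\bigl(\{\omega_\infty\not\equiv\omega_0\}\setminus\{\omega_\infty\equiv 1\}\bigr)=o(1).$$
   Context: Hamming torus: $V=[n]^d$ with $[n]=\{1,\dots,n\}$; two vertices $v,w$ are adjacent ($v\sim w$) iff $v-w$ has exactly one nonzero coordinate. Bootstrap percolation with threshold $\theta$ (a fixed integer, not depending on $n$): starting from $\omega_0\in\{0,1\}^V$, set $\omega_{j+1}(v)=1$ if $\omega_j(v)=1$ or $\sum_{w\sim v}\omega_j(w)\ge\theta$, and $\omega_{j+1}(v)=0$ otherwise; $\omega_\infty$ is the pointwise limit of the increasing sequence $\omega_j$. Under $\mathbb{P}_p$ the values $\omega_0(v)$, $v\in V$, are i.i.d. Bernoulli($p$). An $i$-dimensional subgraph is a set of vertices obtained by fixing $d-i$ coordinates and letting the other $i$ range over $[n]$. For $i\ge1$, $p_{\mathrm c}(i,d)$ (depending on $n,\theta$) is the value of $p$ for which $\mathbb{P}_p(\exists\text{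 an }i\text{-dimensional subgraph }F\text{ with }\omega_\infty|_F\equiv 1)=1/2$. Also $p^*_{\mathrm c}(0,d)$ is the value of $p$ for which $\mathbb{P}_p\bigl(\exists v\in V:\ \sum_{w\sim v}\omega_0(w)\ge\theta\bigr)=1/2$.
   Formalization: The equalities p_c(2,2)=p_c(1,2)=p_c*(0,2), which fail literally for finite n (e.g. θ=3, n≥4), are stated as asymptotic equivalence (ratio tending to 1 as n→∞ for each fixed θ). *)

theory Defs
  imports "HOL-Probability.Probability" "HOL-Library.Landau_Symbols"
begin

text \<open>
  Vertices of the Hamming torus are extensional functions from the coordinate set
  \<open>{..<d}\<close> to \<open>{1..n}\<close>. A configuration is a predicate on vertices, where \<open>True\<close>
  stands for the value 1.
\<close>

type_synonym vertex = "nat \<Rightarrow> nat"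

definition torus :: "nat \<Rightarrow> nat \<Rightarrow> vertex set" where
  "torus n d = {..<d} \<rightarrow>\<^sub>E {1..n}"

definition adj :: "nat \<Rightarrow> vertex \<Rightarrow> vertex \<Rightarrow> bool" where
  "adj d v w \<longleftrightarrow> card {j \<in> {..<d}. v j \<noteq> w j} = 1"

definition open_nbrs :: "nat \<Rightarrow> nat \<Rightarrow> (vertex \<Rightarrow> bool) \<Rightarrow> vertex \<Rightarrow> nat" where
  "open_nbrs n d \<omega> v = card {w \<in> torus n d. adj d v w \<and> \<omega> w}"

definition bootstrap_step ::
    "nat \<Rightarrow> nat \<Rightarrow> nat \<Rightarrow> (vertex \<Rightarrow> bool) \<Rightarrow> (vertex \<Rightarrow> bool)" where
  "bootstrap_step n d \<theta> \<omega> = (\<lambda>v. \<omega> v \<or> (v \<in> torus n d \<and> open_nbrs n d \<omega> v \<ge> \<theta>))"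

text \<open>
  The iterates increase, so their pointwise limit at a vertex is 1 iff some iterate is 1 there.
\<close>

definition bootstrap_limit ::
    "nat \<Rightarrow> nat \<Rightarrow> nat \<Rightarrow> (vertex \<Rightarrow> bool) \<Rightarrow> (vertex \<Rightarrow> bool)" where
  "bootstrap_limit n d \<theta> \<omega> = (\<lambda>v. \<exists>j. (bootstrap_step n d \<theta> ^^ j) \<omega> v)"

text \<open>
  \<open>Pi_pmf\<close> fixes the value \<open>False\<close> outside the torus. \<open>bernoulli_pmf\<close> truncates its
  parameter to \<open>[0,1]\<close>.
\<close>

definition initial_config :: "nat \<Rightarrow> nat \<Rightarrow> real \<Rightarrow> (vertex \<Rightarrow> bool) pmf" where
  "initial_config n d p = Pi_pmf (torus n d) False (\<lambda>_. bernoulli_pmf p)"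

text \<open>The coordinates in \<open>I\<close> are free, the others are fixed to those of \<open>u\<close>.\<close>

definition subgraphs :: "nat \<Rightarrow> nat \<Rightarrow> nat \<Rightarrow> vertex set set" where
  "subgraphs n d i =
     {{v \<in> torus n d. \<forall>j \<in> {..<d} - I. v j = u j} | I u.
        I \<subseteq> {..<d} \<and> card I = i \<and> u \<in> torus n d}"

text \<open>
  The defining equations of the critical probabilities involve polynomials in \<open>p\<close> that,
  for \<open>\<theta> \<ge> 1\<close>, \<open>1 \<le> i \<le> d\<close> and all sufficiently large \<open>n\<close>, increase strictly
  from 0 to 1 on \<open>[0,1]\<close>; hence the definite description.
  For small \<open>n\<close> the value may be unspecified.
\<close>

definition p_crit :: "nat \<Rightarrow> nat \<Rightarrow> nat \<Rightarrow> nat \<Rightarrow> real" where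
  "p_crit i d \<theta> n = (THE p. 0 \<le> p \<and> p \<le> 1 \<and>
     measure_pmf.prob (initial_config n d p)
       {\<omega>. \<exists>F \<in> subgraphs n d i. \<forall>v \<in> F. bootstrap_limit n d \<theta> \<omega> v} = 1 / 2)"

definition p_crit_star0 :: "nat \<Rightarrow> nat \<Rightarrow> nat \<Rightarrow> real" where
  "p_crit_star0 d \<theta> n = (THE p. 0 \<le> p \<and> p \<le> 1 \<and>
     measure_pmf.prob (initial_config n d p)
       {\<omega>. \<exists>v \<in> torus n d. open_nbrs n d \<omega> v \<ge> \<theta>} = 1 / 2)"

end

theory Submission
  imports Defs "HOL-Real_Asymp.Real_Asymp"
begin

text \<open>
  Call a row or a column of the torus a line, and a line dense if at least \<open>k\<close> of its vertices are
  initially open. At density \<open>p = a n\<^bsup>-1-1/k\<^esup>\<close> a line has \<open>m\<close> open vertices with probability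
  of order \<open>n\<^bsup>-m/k\<^esup>\<close>. Among the \<open>n\<close> lines of one direction there are therefore, with high
  probability, arbitrarily many with \<open>k - 1\<close> open vertices, none with \<open>k + 1\<close>, and about a Poisson
  number of dense ones, with mean \<open>a\<^sup>k / k!\<close>.

  The dense lines decide everything. A vertex with \<open>\<theta>\<close> open neighbours lies on a dense line if
  \<open>\<theta> = 2 k - 1\<close>, and on two dense lines if \<open>\<theta> = 2 k\<close>; without such a seed nothing ever changes.
  Conversely a seed grows. One dense line (odd \<open>\<theta>\<close>), or a dense row and a dense column together with their
  crossing (even \<open>\<theta>\<close>), are filled at the crossings with lines that have \<open>k - 1\<close> open vertices. A full line
  raises the latter to \<open>k\<close>, these get filled in turn, and \<open>\<theta>\<close> full parallel lines fill the torus.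
  So, outside an event of vanishing probability, filling the torus, filling some line, and the mere
  existence of a vertex with \<open>\<theta>\<close> open neighbours are all equivalent to the presence of a seed
  (\<open>seed_iff\<close>), and otherwise the configuration is frozen (\<open>not_seed_stuck\<close>).

  It remains to compute the probability of a seed (\<open>seed_prob_limit\<close>). Parallel lines are disjoint and
  hence independent, so each direction has a dense line with probability tending to
  \<open>1 - exp (- a\<^sup>k / k!)\<close>. A row and a column share a vertex, and the asymptotic independence
  of the two directions comes from two opposite correlation inequalities: Harris (\<open>bprob_harris\<close>), and van
  den Berg-Kesten (\<open>bprob_bk\<close>), which applies because the common vertex of a dense row and a dense column
  is closed with high probability (\<open>double_vertex_prob\<close>).

  For a fixed torus, the probability of a nontrivial increasing event is continuous and strictly increasing in
  \<open>p\<close>, so each critical value exists and is unique. The limit of the probability is strictly increasing in \<open>a\<close>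
  and the same for the three events, so the three critical values are all asymptotic to
  \<open>a n\<^bsup>-1-1/k\<^esup>\<close> for the \<open>a\<close> at which the limit is one half (\<open>critical_value_limit\<close>). Finally
  \<open>2 / \<theta> - 1 / k\<close> is at most of order \<open>\<theta>\<^bsup>-2\<^esup>\<close>, which gives the exponent in terms of \<open>\<theta>\<close>.
\<close>

section \<open>Events of independent Bernoulli variables\<close>

definition bprob :: "'a set \<Rightarrow> real \<Rightarrow> (('a \<Rightarrow> bool) \<Rightarrow> bool) \<Rightarrow> real" where
  "bprob X p E = measure_pmf.prob (Pi_pmf X False (\<lambda>_. bernoulli_pmf p)) {\<eta>. E \<eta>}"

lemma bprob_empty [simp]: "bprob {} p E = (if E (\<lambda>_. False) then 1 else 0)"
  by (simp add: bprob_def indicator_def)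

text \<open>
  Conditioning on the value at one site: the facts about product measures below are inductions on
  the set of sites through this identity, applied to the two sections of an event at that site.
\<close>

lemma bprob_insert:
  assumes "finite X" "x \<notin> X" "0 \<le> p" "p \<le> 1"
  shows "bprob (insert x X) p E =
    p * bprob X p (\<lambda>\<eta>. E (\<eta>(x := True))) + (1 - p) * bprob X p (\<lambda>\<eta>. E (\<eta>(x := False)))"
proof -
  let ?M = "Pi_pmf X False (\<lambda>_. bernoulli_pmf p)"
  have Pi: "Pi_pmf (insert x X) False (\<lambda>_. bernoulli_pmf p) =
      bind_pmf (bernoulli_pmf p) (\<lambda>b. map_pmf (\<lambda>\<eta>. \<eta>(x := b)) ?M)"
    using assms by (simp add: Pi_pmf_insert' map_pmf_def)
  have prob_eq: "bprob Y p F = pmf (map_pmf F (Pi_pmf Y False (\<lambda>_. bernoulli_pmf p))) True" for Y F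
    by (simp add: bprob_def pmf_map vimage_def)
  have "bprob (insert x X) p E =
      measure_pmf.expectation (bernoulli_pmf p)
        (\<lambda>b. pmf (map_pmf E (map_pmf (\<lambda>\<eta>. \<eta>(x := b)) ?M)) True)"
    by (simp only: prob_eq Pi map_bind_pmf pmf_bind)
  also have "\<dots> = measure_pmf.expectation (bernoulli_pmf p) (\<lambda>b. bprob X p (\<lambda>\<eta>. E (\<eta>(x := b))))"
    by (simp add: prob_eq map_pmf_comp)
  finally show ?thesis
    using assms by simp
qed

lemma bprob_nonneg [simp]: "0 \<le> bprob X p E"
  and bprob_le_1 [simp]: "bprob X p E \<le> 1"
  by (simp_all add: bprob_def)

lemma bprob_mono: "(\<And>\<eta>. E \<eta> \<Longrightarrow> F \<eta>) \<Longrightarrow> bprob X p E \<le> bprob X p F"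
  unfolding bprob_def by (rule measure_pmf.finite_measure_mono) auto

lemma bprob_not: "bprob X p (\<lambda>\<eta>. \<not> E \<eta>) = 1 - bprob X p E"
  using measure_pmf.prob_compl[of "{\<eta>. E \<eta>}" "Pi_pmf X False (\<lambda>_. bernoulli_pmf p)"]
  by (simp add: bprob_def Compl_eq_Diff_UNIV[symmetric] Collect_neg_eq)

lemma bprob_disj:
  "bprob X p (\<lambda>\<eta>. E \<eta> \<or> F \<eta>) = bprob X p E + bprob X p F - bprob X p (\<lambda>\<eta>. E \<eta> \<and> F \<eta>)"
  using measure_pmf.finite_measure_Union'[of "{\<eta>. E \<eta>}" "Pi_pmf X False (\<lambda>_. bernoulli_pmf p)" "{\<eta>. F \<eta>}"]
    measure_pmf.finite_measure_Diff'[of "{\<eta>. F \<eta>}" "Pi_pmf X False (\<lambda>_. bernoulli_pmf p)" "{\<eta>. E \<eta>}"]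
  by (simp add: bprob_def Collect_disj_eq Collect_conj_eq Int_commute)

lemma bprob_disj_le: "bprob X p (\<lambda>\<eta>. E \<eta> \<or> F \<eta>) \<le> bprob X p E + bprob X p F"
  by (simp add: bprob_disj)

lemma bprob_Bex_le:
  assumes "finite I"
  shows "bprob X p (\<lambda>\<eta>. \<exists>i\<in>I. E i \<eta>) \<le> (\<Sum>i\<in>I. bprob X p (E i))"
proof -
  have "{\<eta>. \<exists>i\<in>I. E i \<eta>} = (\<Union>i\<in>I. {\<eta>. E i \<eta>})" by auto
  then show ?thesis
    using assms by (simp add: bprob_def measure_pmf.finite_measure_subadditive_finite)
qed

definition increasing :: "(('a \<Rightarrow> bool) \<Rightarrow> bool) \<Rightarrow> bool" where
  "increasing E \<longleftrightarrow> (\<forall>\<eta> \<eta>'. E \<eta> \<longrightarrow> (\<forall>x. \<eta> x \<longrightarrow> \<eta>' x) \<longrightarrow> E \<eta>')"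

lemma increasingI: "(\<And>\<eta> \<eta>'. E \<eta> \<Longrightarrow> (\<And>x. \<eta> x \<Longrightarrow> \<eta>' x) \<Longrightarrow> E \<eta>') \<Longrightarrow> increasing E"
  unfolding increasing_def by blast

lemma increasingD: "increasing E \<Longrightarrow> E \<eta> \<Longrightarrow> (\<And>x. \<eta> x \<Longrightarrow> \<eta>' x) \<Longrightarrow> E \<eta>'"
  unfolding increasing_def by blast

lemma increasing_section: "increasing E \<Longrightarrow> increasing (\<lambda>\<eta>. E (\<eta>(x := b)))"
  by (rule increasingI, erule increasingD, assumption) (auto split: if_splits)

lemma bprob_section_mono:
  assumes "increasing E"
  shows "bprob X p (\<lambda>\<eta>. E (\<eta>(x := False))) \<le> bprob X p (\<lambda>\<eta>. E (\<eta>(x := True)))"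
  by (rule bprob_mono, erule increasingD[OF assms]) (auto split: if_splits)

text \<open>
  The Harris inequality. The sections at one site are again increasing, so the induction
  hypothesis bounds the conditional probabilities given that site; averaging over the site then
  contributes a covariance \<open>p (1 - p) (e\<^sub>1 - e\<^sub>0) (f\<^sub>1 - f\<^sub>0)\<close> of two increasing functions of one
  variable, which is nonnegative.
\<close>

lemma bprob_harris:
  assumes "finite X" "0 \<le> p" "p \<le> 1" "increasing E" "increasing F"
  shows "bprob X p E * bprob X p F \<le> bprob X p (\<lambda>\<eta>. E \<eta> \<and> F \<eta>)"
  using assms(1,4,5)
proof (induction X arbitrary: E F rule: finite_induct)
  case (insert x X)
  define e where "e b = bprob X p (\<lambda>\<eta>. E (\<eta>(x := b)))" for b
  define f where "f b = bprob X p (\<lambda>\<eta>. F (\<eta>(x := b)))" for b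
  define h where "h b = bprob X p (\<lambda>\<eta>. E (\<eta>(x := b)) \<and> F (\<eta>(x := b)))" for b
  have "0 \<le> p * (1 - p) * ((e True - e False) * (f True - f False))"
    using assms(2,3) insert.prems
    by (intro mult_nonneg_nonneg) (auto simp: e_def f_def intro!: bprob_section_mono)
  then have "(p * e True + (1 - p) * e False) * (p * f True + (1 - p) * f False)
      \<le> p * (e True * f True) + (1 - p) * (e False * f False)"
    by (simp add: algebra_simps)
  also have "e b * f b \<le> h b" for b
    unfolding e_def f_def h_def by (intro insert.IH increasing_section insert.prems)
  then have "p * (e True * f True) + (1 - p) * (e False * f False) \<le> p * h True + (1 - p) * h False"
    using assms(2,3) by (intro add_mono mult_left_mono) auto
  finally show ?case
    using insert.hyps assms(2,3) by (simp add: bprob_insert e_def f_def h_def)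
qed auto

section \<open>Disjoint occurrence\<close>

text \<open>
  The operation of van den Berg and Kesten, for increasing events: two disjoint sets of open sites
  can be found, the first of which forces \<open>E\<close> and the second of which forces \<open>F\<close>.
\<close>

definition disj_occ where
  "disj_occ E F \<eta> \<longleftrightarrow>
     (\<exists>\<sigma> \<tau>. \<sigma> \<le> \<eta> \<and> \<tau> \<le> \<eta> \<and> (\<forall>x. \<not> (\<sigma> x \<and> \<tau> x)) \<and> E \<sigma> \<and> F \<tau>)"
  for E F :: "('a \<Rightarrow> bool) \<Rightarrow> bool"

lemma disj_occ_section_False:
  "disj_occ E F (\<eta>(x := False))
    \<longleftrightarrow> disj_occ (\<lambda>\<eta>. E (\<eta>(x := False))) (\<lambda>\<eta>. F (\<eta>(x := False))) \<eta>"
proof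
  assume "disj_occ E F (\<eta>(x := False))"
  then obtain \<sigma> \<tau> where *: "\<sigma> \<le> \<eta>(x := False)" "\<tau> \<le> \<eta>(x := False)"
    "\<forall>x. \<not> (\<sigma> x \<and> \<tau> x)" "E \<sigma>" "F \<tau>" by (auto simp: disj_occ_def)
  then have "\<sigma>(x := False) = \<sigma>" "\<tau>(x := False) = \<tau>" by (auto simp: le_fun_def fun_eq_iff)
  with * show "disj_occ (\<lambda>\<eta>. E (\<eta>(x := False))) (\<lambda>\<eta>. F (\<eta>(x := False))) \<eta>"
    unfolding disj_occ_def by (intro exI[of _ \<sigma>] exI[of _ \<tau>]) (auto simp: le_fun_def split: if_splits)
next
  assume "disj_occ (\<lambda>\<eta>. E (\<eta>(x := False))) (\<lambda>\<eta>. F (\<eta>(x := False))) \<eta>"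
  then obtain \<sigma> \<tau> where *: "\<sigma> \<le> \<eta>" "\<tau> \<le> \<eta>"
    "\<forall>x. \<not> (\<sigma> x \<and> \<tau> x)" "E (\<sigma>(x := False))" "F (\<tau>(x := False))" by (auto simp: disj_occ_def)
  then show "disj_occ E F (\<eta>(x := False))"
    unfolding disj_occ_def
    by (intro exI[of _ "\<sigma>(x := False)"] exI[of _ "\<tau>(x := False)"]) (auto simp: le_fun_def)
qed

text \<open>
  A site can belong to the witness of only one of the two events; the other witness does
  without it.
\<close>

lemma disj_occ_section_True:
  assumes "increasing E" "increasing F" "disj_occ E F (\<eta>(x := True))"
  shows "disj_occ (\<lambda>\<eta>. E (\<eta>(x := True))) (\<lambda>\<eta>. F (\<eta>(x := False))) \<eta> \<or>
         disj_occ (\<lambda>\<eta>. E (\<eta>(x := False))) (\<lambda>\<eta>. F (\<eta>(x := True))) \<eta>"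
proof -
  obtain \<sigma> \<tau> where *: "\<sigma> \<le> \<eta>(x := True)" "\<tau> \<le> \<eta>(x := True)"
    "\<forall>x. \<not> (\<sigma> x \<and> \<tau> x)" "E \<sigma>" "F \<tau>" using assms(3) by (auto simp: disj_occ_def)
  have le: "\<sigma>(x := False) \<le> \<eta>" "\<tau>(x := False) \<le> \<eta>"
    using *(1,2) by (auto simp: le_fun_def split: if_splits)
  have T: "E (\<sigma>(x := True))" "F (\<tau>(x := True))"
    using *(4,5) increasingD[OF assms(1)] increasingD[OF assms(2)] by auto
  show ?thesis
  proof (cases "\<tau> x")
    case True
    then have "\<sigma>(x := False) = \<sigma>" using *(3) by (auto simp: fun_eq_iff)
    then have "disj_occ (\<lambda>\<eta>. E (\<eta>(x := False))) (\<lambda>\<eta>. F (\<eta>(x := True))) \<eta>"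
      unfolding disj_occ_def using le T * 
      by (intro exI[of _ "\<sigma>(x := False)"] exI[of _ "\<tau>(x := False)"]) auto
    then show ?thesis ..
  next
    case False
    then have "\<tau>(x := False) = \<tau>" by (auto simp: fun_eq_iff)
    then have "disj_occ (\<lambda>\<eta>. E (\<eta>(x := True))) (\<lambda>\<eta>. F (\<eta>(x := False))) \<eta>"
      unfolding disj_occ_def using le T * 
      by (intro exI[of _ "\<sigma>(x := False)"] exI[of _ "\<tau>(x := False)"]) auto
    then show ?thesis ..
  qed
qed

lemma disj_occ_mono:
  "disj_occ E F \<eta> \<Longrightarrow> (\<And>\<eta>. E \<eta> \<Longrightarrow> E' \<eta>) \<Longrightarrow> (\<And>\<eta>. F \<eta> \<Longrightarrow> F' \<eta>) \<Longrightarrow> disj_occ E' F' \<eta>"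
  unfolding disj_occ_def by blast

text \<open>
  The inequality of van den Berg and Kesten. If the site \<open>x\<close> is open, then one of two disjoint
  occurrences of sections takes place; both take place if already the closed sections occur
  disjointly. Inclusion-exclusion for these two and the induction hypothesis leave the coefficient
  \<open>1 - 2 p\<close> in front of the closed sections, whose sign is controlled by \<open>p \<le> 1 / 2\<close>. What
  remains is that \<open>p\<^sup>2 (e\<^sub>1 - e\<^sub>0) (f\<^sub>1 - f\<^sub>0)\<close> is nonnegative.
\<close>

lemma bprob_bk:
  assumes "finite X" "0 \<le> p" "p \<le> 1/2" "increasing E" "increasing F"
  shows "bprob X p (disj_occ E F) \<le> bprob X p E * bprob X p F"
  using assms(1,4,5)
proof (induction X arbitrary: E F rule: finite_induct)
  case empty
  have "E (\<lambda>_. False)" "F (\<lambda>_. False)" if "disj_occ E F (\<lambda>_. False)"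
  proof -
    from that obtain \<sigma> \<tau> where *: "\<sigma> \<le> (\<lambda>_. False)" "\<tau> \<le> (\<lambda>_. False)" "E \<sigma>" "F \<tau>"
      unfolding disj_occ_def by auto
    then have "\<sigma> = (\<lambda>_. False)" "\<tau> = (\<lambda>_. False)" by (auto simp: le_fun_def)
    with * show "E (\<lambda>_. False)" "F (\<lambda>_. False)" by auto
  qed
  then show ?case by auto
next
  case (insert x X)
  define E' where "E' b = (\<lambda>\<eta>. E (\<eta>(x := b)))" for b
  define F' where "F' b = (\<lambda>\<eta>. F (\<eta>(x := b)))" for b
  define D where "D b c = disj_occ (E' b) (F' c)" for b c
  define e where "e b = bprob X p (E' b)" for b
  define f where "f b = bprob X p (F' b)" for b
  have E'_mono: "E' False \<eta> \<Longrightarrow> E' True \<eta>" and F'_mono: "F' False \<eta> \<Longrightarrow> F' True \<eta>" for \<eta>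
    unfolding E'_def F'_def
    by (erule increasingD[OF insert.prems(1)] increasingD[OF insert.prems(2)],
        auto split: if_splits)+
  have IH: "bprob X p (D b c) \<le> e b * f c" for b c
    unfolding D_def e_def f_def E'_def F'_def
    by (intro insert.IH increasing_section insert.prems)
  have "bprob (insert x X) p (disj_occ E F) =
      p * bprob X p (\<lambda>\<eta>. disj_occ E F (\<eta>(x := True))) + (1 - p) * bprob X p (D False False)"
    using insert.hyps assms(2,3)
    by (simp add: bprob_insert disj_occ_section_False D_def E'_def F'_def)
  also have "bprob X p (\<lambda>\<eta>. disj_occ E F (\<eta>(x := True)))
      \<le> bprob X p (\<lambda>\<eta>. D True False \<eta> \<or> D False True \<eta>)"
    unfolding D_def E'_def F'_def by (rule bprob_mono, erule disj_occ_section_True[OF insert.prems])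
  also have "\<dots> = bprob X p (D True False) + bprob X p (D False True)
      - bprob X p (\<lambda>\<eta>. D True False \<eta> \<and> D False True \<eta>)"
    by (rule bprob_disj)
  also have "\<dots> \<le> bprob X p (D True False) + bprob X p (D False True) - bprob X p (D False False)"
    using disj_occ_mono E'_mono F'_mono
    by (intro diff_left_mono bprob_mono) (simp add: D_def, blast)
  finally have "bprob (insert x X) p (disj_occ E F) \<le>
      p * (bprob X p (D True False) + bprob X p (D False True) - bprob X p (D False False))
      + (1 - p) * bprob X p (D False False)"
    using assms(2) by (simp add: mult_left_mono)
  also have "\<dots> = p * bprob X p (D True False) + p * bprob X p (D False True)
      + (1 - 2 * p) * bprob X p (D False False)"
    by (simp add: algebra_simps)
  also have "\<dots> \<le> p * (e True * f False) + p * (e False * f True) + (1 - 2 * p) * (e False * f False)"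
    using assms(2,3) IH by (intro add_mono mult_left_mono) auto
  also have "\<dots> \<le> (p * e True + (1 - p) * e False) * (p * f True + (1 - p) * f False)"
  proof -
    have "0 \<le> p\<^sup>2 * ((e True - e False) * (f True - f False))"
      using E'_mono F'_mono by (intro mult_nonneg_nonneg) (auto simp: e_def f_def intro!: bprob_mono)
    then show ?thesis by (simp add: algebra_simps power2_eq_square)
  qed
  finally show ?case
    using insert.hyps assms(2,3) by (simp add: bprob_insert e_def f_def E'_def F'_def)
qed

section \<open>Independence of disjoint sets of sites\<close>

definition depends_on :: "'a set \<Rightarrow> (('a \<Rightarrow> bool) \<Rightarrow> bool) \<Rightarrow> bool" where
  "depends_on A E \<longleftrightarrow> (\<forall>\<eta> \<eta>'. (\<forall>x\<in>A. \<eta> x = \<eta>' x) \<longrightarrow> E \<eta> = E \<eta>')"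

lemma depends_onD: "depends_on A E \<Longrightarrow> (\<And>x. x \<in> A \<Longrightarrow> \<eta> x = \<eta>' x) \<Longrightarrow> E \<eta> = E \<eta>'"
  unfolding depends_on_def by blast

lemma depends_on_section:
  "depends_on A E \<Longrightarrow> depends_on A (\<lambda>\<eta>. E (\<eta>(x := b)))"
  unfolding depends_on_def by (simp)

lemma section_irrelevant: "depends_on A E \<Longrightarrow> x \<notin> A \<Longrightarrow> E (\<eta>(x := b)) = E \<eta>"
  by (erule depends_onD) auto

lemma bprob_indep:
  assumes "finite X" "0 \<le> p" "p \<le> 1" "depends_on A E" "depends_on B F" "A \<inter> B = {}"
  shows "bprob X p (\<lambda>\<eta>. E \<eta> \<and> F \<eta>) = bprob X p E * bprob X p F"
  using assms(1,4,5)
proof (induction X arbitrary: E F rule: finite_induct)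
  case (insert x X)
  have IH: "bprob X p (\<lambda>\<eta>. E (\<eta>(x := b)) \<and> F (\<eta>(x := b)))
      = bprob X p (\<lambda>\<eta>. E (\<eta>(x := b))) * bprob X p (\<lambda>\<eta>. F (\<eta>(x := b)))" for b
    by (intro insert.IH depends_on_section insert.prems)
  note step = bprob_insert[OF insert.hyps assms(2,3)]
  consider "x \<notin> A" | "x \<notin> B" using assms(6) by blast
  then show ?case
  proof cases
    case 1
    then have E: "E (\<eta>(x := b)) = E \<eta>" for \<eta> b by (rule section_irrelevant[OF insert.prems(1)])
    show ?thesis
      using IH[of True] IH[of False] unfolding step E by (simp only: algebra_simps)
  next
    case 2
    then have F: "F (\<eta>(x := b)) = F \<eta>" for \<eta> b by (rule section_irrelevant[OF insert.prems(2)])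
    show ?thesis
      using IH[of True] IH[of False] unfolding step F by (simp add: algebra_simps)
  qed
qed auto

lemma bprob_Ball_indep:
  assumes "finite X" "0 \<le> p" "p \<le> 1" "finite I" "disjoint_family_on A I"
    "\<And>i. i \<in> I \<Longrightarrow> depends_on (A i) (E i)"
  shows "bprob X p (\<lambda>\<eta>. \<forall>i\<in>I. E i \<eta>) = (\<Prod>i\<in>I. bprob X p (E i))"
  using assms(4-6)
proof (induction I rule: finite_induct)
  case empty
  then show ?case by (simp add: bprob_def)
next
  case (insert i I)
  have d: "depends_on (\<Union>j\<in>I. A j) (\<lambda>\<eta>. \<forall>j\<in>I. E j \<eta>)"
    unfolding depends_on_def
  proof (intro allI impI ball_cong refl)
    fix \<eta> \<eta>' :: "'a \<Rightarrow> bool" and j assume "\<forall>x\<in>(\<Union>j\<in>I. A j). \<eta> x = \<eta>' x" "j \<in> I"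
    then show "E j \<eta> = E j \<eta>'"
      using insert.prems(2)[of j] by (intro depends_onD[of "A j" "E j"]) auto
  qed
  have "A i \<inter> (\<Union>j\<in>I. A j) = {}"
    using insert.prems(1) insert.hyps by (auto simp: disjoint_family_on_def)
  then show ?case
    using bprob_indep[OF assms(1-3) insert.prems(2)[of i] d] insert
    by (auto simp: disjoint_family_on_def)
qed

lemma bprob_all_open:
  assumes "finite X" "0 \<le> p" "p \<le> 1" "S \<subseteq> X"
  shows "bprob X p (\<lambda>\<eta>. \<forall>x\<in>S. \<eta> x) = p ^ card S"
proof -
  have fin: "finite S" using assms finite_subset by blast
  have single: "bprob X p (\<lambda>\<eta>. \<eta> x) = p" if "x \<in> S" for x
  proof -
    have eq: "insert x (X - {x}) = X" using that assms by blast
    have "bprob (insert x (X - {x})) p (\<lambda>\<eta>. \<eta> x) = p"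
      using assms by (subst bprob_insert) (auto simp: bprob_def)
    then show ?thesis by (simp only: eq)
  qed
  have "bprob X p (\<lambda>\<eta>. \<forall>x\<in>S. \<eta> x) = (\<Prod>x\<in>S. bprob X p (\<lambda>\<eta>. \<eta> x))"
    using assms fin
    by (intro bprob_Ball_indep[where A = "\<lambda>x. {x}"]) (auto simp: disjoint_family_on_def depends_on_def)
  with single show ?thesis by simp
qed

lemma bprob_some_set_open:
  assumes "finite X" "0 \<le> p" "p \<le> 1" "finite K" "\<And>S. S \<in> K \<Longrightarrow> S \<subseteq> X \<and> card S = m"
  shows "bprob X p (\<lambda>\<eta>. \<exists>S\<in>K. \<forall>x\<in>S. \<eta> x) \<le> real (card K) * p ^ m"
proof -
  have "bprob X p (\<lambda>\<eta>. \<exists>S\<in>K. \<forall>x\<in>S. \<eta> x) \<le> (\<Sum>S\<in>K. bprob X p (\<lambda>\<eta>. \<forall>x\<in>S. \<eta> x))"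
    by (rule bprob_Bex_le[OF assms(4)])
  also have "\<dots> = (\<Sum>S\<in>K. p ^ m)"
    using assms bprob_all_open[OF assms(1-3)] by (intro sum.cong) auto
  finally show ?thesis by simp
qed

section \<open>Dependence on the density\<close>

text \<open>
  Raising \<open>p\<close> at the site \<open>x\<close> shifts weight from the closed to the open section, which is the
  more probable one; raising it at the other sites is the induction hypothesis.
\<close>

lemma bprob_weak_mono:
  assumes "finite X" "0 \<le> p" "p \<le> q" "q \<le> 1" "increasing E"
  shows "bprob X p E \<le> bprob X q E"
  using assms(1,5)
proof (induction X arbitrary: E rule: finite_induct)
  case (insert x X)
  define e where "e r b = bprob X r (\<lambda>\<eta>. E (\<eta>(x := b)))" for r b
  have "e p False \<le> e p True"
    unfolding e_def by (rule bprob_section_mono[OF insert.prems])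
  then have "(q - p) * e p False \<le> (q - p) * e p True"
    using assms(3) by (intro mult_left_mono) auto
  then have "p * e p True + (1 - p) * e p False \<le> q * e p True + (1 - q) * e p False"
    by (simp add: algebra_simps)
  also have "\<dots> \<le> q * e q True + (1 - q) * e q False"
    unfolding e_def using assms(2-4)
    by (intro add_mono mult_left_mono insert.IH increasing_section insert.prems) auto
  finally show ?case
    using insert.hyps assms(2-4) by (simp add: bprob_insert e_def)
qed auto

lemma bprob_0: "finite X \<Longrightarrow> bprob X 0 E = (if E (\<lambda>_. False) then 1 else 0)"
proof (induction X arbitrary: E rule: finite_induct)
  case (insert x X)
  then show ?case by (simp add: bprob_insert fun_upd_idem)
qed auto

lemma bprob_1: "finite X \<Longrightarrow> bprob X 1 E = (if E (\<lambda>x. x \<in> X) then 1 else 0)"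
proof (induction X arbitrary: E rule: finite_induct)
  case (insert x X)
  have "(\<lambda>y. y \<in> X)(x := True) = (\<lambda>y. y \<in> insert x X)" by (auto simp: fun_eq_iff)
  then show ?case
    using bprob_insert[OF insert.hyps, of 1 E] insert.IH[of "\<lambda>\<eta>. E (\<eta>(x := True))"] by simp
qed auto

lemma bprob_trivial:
  assumes "increasing E" "finite X" "0 \<le> p" "p \<le> 1"
  shows "E (\<lambda>_. False) \<Longrightarrow> bprob X p E = 1" "\<not> E (\<lambda>x. x \<in> X) \<Longrightarrow> bprob X p E = 0"
  using bprob_weak_mono[OF assms(2), of 0 p E] bprob_weak_mono[OF assms(2), of p 1 E] assms
    bprob_le_1[of X p E] bprob_nonneg[of X p E]
  by (auto simp: bprob_0 bprob_1 split: if_splits intro: antisym)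

text \<open>
  The increment splits into the gap between the two sections at a site and the increments of the
  two sections. One of the three is positive: either a section is itself nontrivial, or the open
  section is certain and the closed one impossible, so that the gap is 1.
\<close>

lemma bprob_strict_mono:
  assumes "finite X" "0 < p" "p < q" "q < 1" "increasing E" "\<not> E (\<lambda>_. False)" "E (\<lambda>x. x \<in> X)"
  shows "bprob X p E < bprob X q E"
  using assms(1,5-)
proof (induction X arbitrary: E rule: finite_induct)
  case (insert x X)
  define e where "e r b = bprob X r (\<lambda>\<eta>. E (\<eta>(x := b)))" for r b
  have sec: "e p False \<le> e p True"
    unfolding e_def by (rule bprob_section_mono[OF insert.prems(1)])
  have weak: "e p b \<le> e q b" for b
    unfolding e_def using assms insert by (intro bprob_weak_mono increasing_section) auto
  have upd: "(\<lambda>y. y \<in> X)(x := True) = (\<lambda>y. y \<in> insert x X)" "(\<lambda>y. y \<in> X)(x := False) = (\<lambda>y. y \<in> X)"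
    "(\<lambda>_. False)(x := False) = (\<lambda>_. False)"
    using insert.hyps by (auto simp: fun_eq_iff)
  have strict: "e p b < e q b" 
    if "\<not> E ((\<lambda>_. False)(x := b))" "E ((\<lambda>y. y \<in> X)(x := b))" for b
    unfolding e_def by (rule insert.IH) (fact increasing_section[OF insert.prems(1)] that)+
  have "(q - p) * (e p True - e p False) + q * (e q True - e p True) + (1 - q) * (e q False - e p False) > 0"
    (is "?a + ?b + ?c > 0")
  proof -
    have nn: "?a \<ge> 0" "?b \<ge> 0" "?c \<ge> 0"
      using sec weak assms by auto
    consider "E (\<lambda>y. y \<in> X)" | "\<not> E ((\<lambda>_. False)(x := True))" |
      "\<not> E (\<lambda>y. y \<in> X)" "E ((\<lambda>_. False)(x := True))" by blast
    then show ?thesis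
    proof cases
      case 1
      then have "?c > 0"
        using strict[of False] insert.prems assms by (simp only: upd) auto
      with nn show ?thesis by linarith
    next
      case 2
      then have "?b > 0"
        using strict[of True] insert.prems assms by (simp only: upd) auto
      with nn show ?thesis by linarith
    next
      case 3
      have "e p False = 0" "e p True = 1"
        unfolding e_def using 3 assms insert.hyps insert.prems upd
        by (auto intro!: bprob_trivial increasing_section)
      then have "?a > 0" using assms by auto
      with nn show ?thesis by linarith
    qed
  qed
  then have "p * e p True + (1 - p) * e p False < q * e q True + (1 - q) * e q False"
    by (simp add: algebra_simps)
  then show ?case
    using insert.hyps assms(2-4) by (simp add: bprob_insert e_def)
qed auto

lemma bprob_continuous:
  assumes "finite X"
  shows "continuous_on {0..1} (\<lambda>p. bprob X p E)"
  using assms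
proof (induction X arbitrary: E rule: finite_induct)
  case (insert x X)
  have "continuous_on {0..1} (\<lambda>p. p * bprob X p (\<lambda>\<eta>. E (\<eta>(x := True)))
      + (1 - p) * bprob X p (\<lambda>\<eta>. E (\<eta>(x := False))))"
    by (intro continuous_intros insert.IH)
  then show ?case
    by (rule continuous_on_eq) (use insert.hyps in \<open>auto simp: bprob_insert\<close>)
qed auto

text \<open>
  This is what makes the definite descriptions of the critical values meaningful. The interval is
  closed here, whereas strict monotonicity is for the open interval; but at its ends the
  probability is 0 or 1.
\<close>

lemma bprob_half_unique:
  assumes "finite X" "increasing E" "\<not> E (\<lambda>_. False)" "E (\<lambda>x. x \<in> X)"
  shows "\<exists>!p. 0 \<le> p \<and> p \<le> 1 \<and> bprob X p E = 1 / 2"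
proof -
  have "\<exists>p\<ge>0. p \<le> 1 \<and> bprob X p E = 1 / 2"
    using assms bprob_continuous[OF assms(1), of E]
    by (intro IVT') (auto simp: bprob_0 bprob_1)
  moreover have "p = q" if "0 \<le> p" "p \<le> 1" "bprob X p E = 1/2" "0 \<le> q" "q \<le> 1" "bprob X q E = 1/2" for p q
  proof -
    have *: "0 < r \<and> r < 1" if "0 \<le> r" "r \<le> 1" "bprob X r E = 1/2" for r
      using that assms by (cases "r = 0"; cases "r = 1") (auto simp: bprob_0 bprob_1)
    show ?thesis
      using *[of p] *[of q] bprob_strict_mono[OF assms(1) _ _ _ assms(2-4), of p q]
        bprob_strict_mono[OF assms(1) _ _ _ assms(2-4), of q p] that
      by (cases p q rule: linorder_cases) auto
  qed
  ultimately show ?thesis by blast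
qed

section \<open>Lines of the two-dimensional Hamming torus\<close>

definition line :: "nat \<Rightarrow> nat \<Rightarrow> nat \<Rightarrow> vertex set" where
  "line n b i = {v \<in> torus n 2. v b = i}"

text \<open>
  For \<open>b < 2\<close> the other coordinate is \<open>1 - b\<close>, so that one statement about the line \<open>i\<close> that fixes
  coordinate \<open>b\<close> and the line \<open>j\<close> across it serves rows and columns alike; this is their common
  vertex.
\<close>

definition crossing :: "nat \<Rightarrow> nat \<Rightarrow> nat \<Rightarrow> vertex" where
  "crossing b i j = (\<lambda>t\<in>{..<2}. if t = b then i else j)"

definition cnt :: "('a \<Rightarrow> bool) \<Rightarrow> 'a set \<Rightarrow> nat" where
  "cnt \<omega> A = card {x \<in> A. \<omega> x}"

lemma finite_torus [simp]: "finite (torus n d)"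
  by (simp add: torus_def finite_PiE)

lemma line_subset: "line n b i \<subseteq> torus n 2"
  by (auto simp: line_def)

lemma finite_line [simp]: "finite (line n b i)"
  by (rule finite_subset[OF line_subset finite_torus])

lemma torus_coord: "v \<in> torus n 2 \<Longrightarrow> b < 2 \<Longrightarrow> v b \<in> {1..n}"
  unfolding torus_def by (erule PiE_mem) simp

lemma lessThan_2: "{..<2::nat} = {0, 1}"
  by (simp add: numeral_2_eq_2 lessThan_Suc insert_commute)

lemma crossing_in_torus: "i \<in> {1..n} \<Longrightarrow> j \<in> {1..n} \<Longrightarrow> crossing b i j \<in> torus n 2"
  by (auto simp: crossing_def torus_def)

lemma crossing_coord [simp]:
  "b < 2 \<Longrightarrow> crossing b i j b = i" "b < 2 \<Longrightarrow> crossing b i j (Suc 0 - b) = j"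
  by (cases b; simp add: crossing_def)+

lemma torus_vertex_eq: "v \<in> torus n 2 \<Longrightarrow> b < 2 \<Longrightarrow> v = crossing b (v b) (v (1 - b))"
proof
  fix t assume v: "v \<in> torus n 2" and b: "b < 2"
  show "v t = crossing b (v b) (v (1 - b)) t"
  proof (cases "t < 2")
    case True
    then have "t = b \<or> t = 1 - b" using b by linarith
    then show ?thesis using True by (auto simp: crossing_def)
  next
    case False
    then show ?thesis using v by (auto simp: crossing_def torus_def PiE_def extensional_def)
  qed
qed

lemma crossing_inj: "b < 2 \<Longrightarrow> inj_on (crossing b i) A"
  by (rule inj_on_inverseI[where g = "\<lambda>v. v (Suc 0 - b)"]) simp

lemma line_eq_image: "b < 2 \<Longrightarrow> i \<in> {1..n} \<Longrightarrow> line n b i = crossing b i ` {1..n}"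
proof (intro equalityI subsetI)
  fix v assume b: "b < 2" and v: "v \<in> line n b i"
  have v': "v \<in> torus n 2" "v b = i" using v by (auto simp: line_def)
  have "v (1 - b) \<in> {1..n}" using torus_coord[OF v'(1), of "1 - b"] by simp
  moreover have "v = crossing b i (v (1 - b))" using torus_vertex_eq[OF v'(1) b] v'(2) by simp
  ultimately show "v \<in> crossing b i ` {1..n}" by blast
qed (auto simp: line_def crossing_in_torus)

lemma card_line: "b < 2 \<Longrightarrow> i \<in> {1..n} \<Longrightarrow> card (line n b i) = n"
  by (simp add: line_eq_image card_image crossing_inj)

lemma line_Int_line:
  "b < 2 \<Longrightarrow> v \<in> line n b i \<Longrightarrow> v \<in> line n (1 - b) j \<Longrightarrow> v = crossing b i j"
  using torus_vertex_eq[of v n b] unfolding line_def by blast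

lemma crossing_in_lines:
  assumes "b < 2" "i \<in> {1..n}" "j \<in> {1..n}"
  shows "crossing b i j \<in> line n b i" "crossing b i j \<in> line n (1 - b) j"
  using assms by (auto simp: line_def crossing_in_torus)

lemma cnt_line:
  assumes "b < 2" "i \<in> {1..n}"
  shows "cnt \<omega> (line n b i) = card {j \<in> {1..n}. \<omega> (crossing b i j)}"
proof -
  have "{v \<in> line n b i. \<omega> v} = crossing b i ` {j \<in> {1..n}. \<omega> (crossing b i j)}"
    using assms by (auto simp: line_eq_image)
  then show ?thesis
    using assms by (simp add: cnt_def card_image crossing_inj)
qed

lemma cnt_mono: "finite A \<Longrightarrow> (\<And>x. x \<in> A \<Longrightarrow> \<omega> x \<Longrightarrow> \<omega>' x) \<Longrightarrow> cnt \<omega> A \<le> cnt \<omega>' A"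
  unfolding cnt_def by (rule card_mono) auto

lemma cnt_Diff_le: "finite A \<Longrightarrow> cnt \<omega> (A - B) \<le> cnt \<omega> A"
  unfolding cnt_def by (rule card_mono) auto

lemma adj_2: "adj 2 v w \<longleftrightarrow> (v 0 \<noteq> w 0) \<noteq> (v 1 \<noteq> w 1)"
proof -
  have "{j \<in> {..<2}. v j \<noteq> w j} = {..<2} \<inter> {j. v j \<noteq> w j}" by blast
  then have "card {j \<in> {..<2}. v j \<noteq> w j} = (\<Sum>j<2. of_bool (v j \<noteq> w j))"
    by simp
  also have "\<dots> = of_bool (v 0 \<noteq> w 0) + of_bool (v 1 \<noteq> w 1)"
    by (simp only: lessThan_2) simp
  finally show ?thesis by (simp add: adj_def)
qed

text \<open>
  The neighbours of a vertex are the other vertices on the two lines through it, and these two lines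
  have no further vertex in common.
\<close>

lemma open_nbrs_2:
  assumes "v \<in> torus n 2" "b < 2"
  shows "open_nbrs n 2 \<omega> v =
    cnt \<omega> (line n b (v b) - {v}) + cnt \<omega> (line n (1 - b) (v (1 - b)) - {v})"
proof -
  have ext: "w = v \<longleftrightarrow> w 0 = v 0 \<and> w 1 = v 1" if "w \<in> torus n 2" for w
    using torus_vertex_eq[OF that, of 0] torus_vertex_eq[OF assms(1), of 0]
    by (metis diff_zero zero_less_numeral)
  let ?S = "\<lambda>b. {w \<in> line n b (v b) - {v}. \<omega> w}"
  have "{w \<in> torus n 2. adj 2 v w \<and> \<omega> w} = ?S 0 \<union> ?S 1"
    by (auto simp: line_def adj_2 ext)
  moreover have "?S 0 \<inter> ?S 1 = {}"
    by (auto simp: line_def ext)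
  ultimately have "open_nbrs n 2 \<omega> v = card (?S 0) + card (?S 1)"
    by (simp add: open_nbrs_def card_Un_disjoint)
  moreover have "b = 0 \<or> b = 1" using assms(2) by linarith
  ultimately show ?thesis
    by (auto simp: cnt_def)
qed

lemma open_nbrs_le_cnt:
  assumes "v \<in> torus n 2" "b < 2"
  shows "open_nbrs n 2 \<omega> v \<le> cnt \<omega> (line n b (v b)) + cnt \<omega> (line n (1 - b) (v (1 - b)))"
  unfolding open_nbrs_2[OF assms] by (intro add_mono cnt_Diff_le) simp_all

lemma open_nbrs_mono: "(\<And>v. \<omega> v \<Longrightarrow> \<omega>' v) \<Longrightarrow> open_nbrs n d \<omega> v \<le> open_nbrs n d \<omega>' v"
  unfolding open_nbrs_def by (rule card_mono) auto

section \<open>The final configuration\<close>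

lemma bootstrap_step_iff:
  "bootstrap_step n d \<theta> \<omega> v \<longleftrightarrow> \<omega> v \<or> (v \<in> torus n d \<and> \<theta> \<le> open_nbrs n d \<omega> v)"
  by (simp add: bootstrap_step_def)

lemma step_iterate_mono:
  assumes "\<And>v. \<omega> v \<Longrightarrow> \<omega>' v" "(bootstrap_step n d \<theta> ^^ j) \<omega> v"
  shows "(bootstrap_step n d \<theta> ^^ j) \<omega>' v"
  using assms(2)
proof (induction j arbitrary: v)
  case 0
  then show ?case using assms(1) by simp
next
  case (Suc j)
  have "open_nbrs n d ((bootstrap_step n d \<theta> ^^ j) \<omega>) v
      \<le> open_nbrs n d ((bootstrap_step n d \<theta> ^^ j) \<omega>') v"
    by (rule open_nbrs_mono) (rule Suc.IH)
  with Suc.prems show ?case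
    using Suc.IH[of v] bootstrap_step_iff[of n d \<theta> "(bootstrap_step n d \<theta> ^^ j) \<omega>" v]
      bootstrap_step_iff[of n d \<theta> "(bootstrap_step n d \<theta> ^^ j) \<omega>'" v]
    by auto
qed

lemma bootstrap_limit_mono:
  "(\<And>v. \<omega> v \<Longrightarrow> \<omega>' v) \<Longrightarrow> bootstrap_limit n d \<theta> \<omega> v \<Longrightarrow> bootstrap_limit n d \<theta> \<omega>' v"
  unfolding bootstrap_limit_def using step_iterate_mono by blast

lemma bootstrap_limit_ge: "\<omega> v \<Longrightarrow> bootstrap_limit n d \<theta> \<omega> v"
  unfolding bootstrap_limit_def by (rule exI[of _ 0]) simp

lemma step_iterate_le:
  assumes "(bootstrap_step n d \<theta> ^^ i) \<omega> v" "i \<le> j"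
  shows "(bootstrap_step n d \<theta> ^^ j) \<omega> v"
  using assms(2,1) by (induction j rule: dec_induct) (simp_all add: bootstrap_step_iff[of _ _ _ "(_ ^^ _) _"])

definition closed_config :: "nat \<Rightarrow> nat \<Rightarrow> (vertex \<Rightarrow> bool) \<Rightarrow> bool" where
  "closed_config n \<theta> \<sigma> \<longleftrightarrow> (\<forall>v\<in>torus n 2. \<theta> \<le> open_nbrs n 2 \<sigma> v \<longrightarrow> \<sigma> v)"

text \<open>
  The torus is finite, so some iterate already contains every vertex that is ever opened; one more
  step of the dynamics then opens \<open>v\<close>.
\<close>

lemma bootstrap_limit_closed: "closed_config n \<theta> (bootstrap_limit n 2 \<theta> \<omega>)"
  unfolding closed_config_def
proof (intro ballI impI)
  let ?it = "\<lambda>j. (bootstrap_step n 2 \<theta> ^^ j) \<omega>"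
  fix v assume v: "v \<in> torus n 2" "\<theta> \<le> open_nbrs n 2 (bootstrap_limit n 2 \<theta> \<omega>) v"
  define T where "T w = (LEAST j. ?it j w)" for w
  define N where "N = Max (insert 0 (T ` torus n 2))"
  have "?it N w" if w: "w \<in> torus n 2" "bootstrap_limit n 2 \<theta> \<omega> w" for w
  proof (rule step_iterate_le)
    show "?it (T w) w"
      using w(2) unfolding T_def bootstrap_limit_def by (elim exE) (rule LeastI)
    show "T w \<le> N"
      unfolding N_def using w(1) by (intro Max_ge) auto
  qed
  then have "open_nbrs n 2 (bootstrap_limit n 2 \<theta> \<omega>) v \<le> open_nbrs n 2 (?it N) v"
    unfolding open_nbrs_def by (intro card_mono) auto
  with v have "?it (Suc N) v"
    using bootstrap_step_iff[of n 2 \<theta> "?it N" v] by auto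
  then show "bootstrap_limit n 2 \<theta> \<omega> v"
    unfolding bootstrap_limit_def by blast
qed

lemma bootstrap_limit_stuck:
  assumes "\<And>v. v \<in> torus n d \<Longrightarrow> open_nbrs n d \<omega> v < \<theta>"
  shows "bootstrap_limit n d \<theta> \<omega> = \<omega>"
proof -
  have "bootstrap_step n d \<theta> \<omega> = \<omega>"
    using assms by (auto simp: bootstrap_step_iff fun_eq_iff not_le[symmetric])
  then have "(bootstrap_step n d \<theta> ^^ j) \<omega> = \<omega>" for j
    by (induction j) auto
  then show ?thesis by (simp add: bootstrap_limit_def fun_eq_iff)
qed

section \<open>Growth from dense lines\<close>

text \<open>
  A closed vertex contributes to neither of the two counts, so all vertices counted are its
  neighbours; if it is open there is nothing to prove.
\<close>

lemma crossing_filled: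
  assumes "closed_config n \<theta> \<sigma>" "b < 2" "i \<in> {1..n}" "j \<in> {1..n}"
    "\<theta> \<le> cnt \<sigma> (line n b i) + cnt \<sigma> (line n (1 - b) j)"
  shows "\<sigma> (crossing b i j)"
proof (rule ccontr)
  let ?v = "crossing b i j"
  assume not: "\<not> \<sigma> ?v"
  then have "cnt \<sigma> (A - {?v}) = cnt \<sigma> A" for A
    unfolding cnt_def by (intro arg_cong[where f = card]) auto
  then have "\<theta> \<le> open_nbrs n 2 \<sigma> ?v"
    using assms by (simp add: open_nbrs_2[of _ n b] crossing_in_torus)
  with assms not show False
    by (auto simp: closed_config_def crossing_in_torus)
qed

lemma line_filled:
  assumes "closed_config n \<theta> \<sigma>" "b < 2" "i \<in> {1..n}" "\<theta> \<le> cnt \<sigma> (line n b i)" "j \<in> {1..n}"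
  shows "\<sigma> (crossing b i j)"
  by (rule crossing_filled[OF assms(1-3,5)]) (use assms(4) in linarith)

lemma card_le_cnt_line:
  assumes "b < 2" "i \<in> {1..n}" "J \<subseteq> {1..n}" "\<And>j. j \<in> J \<Longrightarrow> \<sigma> (crossing b i j)"
  shows "card J \<le> cnt \<sigma> (line n b i)"
  unfolding cnt_line[OF assms(1,2)] using assms(3,4) by (intro card_mono) auto

lemma crossing_swap: "b < 2 \<Longrightarrow> crossing (1 - b) j i = crossing b i j"
  by (cases b) (auto simp: crossing_def fun_eq_iff)

text \<open>
  The lines in \<open>J\<close> become full and thus put \<open>\<theta>\<close> open vertices on every line across them, which
  is then filled as well.
\<close>

lemma all_filled:
  assumes "closed_config n \<theta> \<sigma>" "b < 2" "J \<subseteq> {1..n}" "\<theta> \<le> card J"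
    "\<And>j. j \<in> J \<Longrightarrow> \<theta> \<le> cnt \<sigma> (line n b j)" "v \<in> torus n 2"
  shows "\<sigma> v"
proof -
  have vb: "v b \<in> {1..n}" "v (1 - b) \<in> {1..n}"
    using assms torus_coord[of v n b] torus_coord[of v n "1 - b"] by auto
  have "\<sigma> (crossing (1 - b) (v (1 - b)) j)" if "j \<in> J" for j
    using line_filled[OF assms(1,2) _ assms(5)[OF that] vb(2)] that assms(3)
      crossing_swap[OF assms(2)] by auto
  then have "card J \<le> cnt \<sigma> (line n (1 - b) (v (1 - b)))"
    using assms vb by (intro card_le_cnt_line) auto
  with assms(4) have "\<sigma> (crossing (1 - b) (v (1 - b)) (v b))"
    using assms vb by (intro line_filled[OF assms(1)]) auto
  then show ?thesis
    using crossing_swap[OF assms(2)] torus_vertex_eq[OF assms(6,2)] by metis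
qed

definition has_line :: "nat \<Rightarrow> nat \<Rightarrow> nat \<Rightarrow> (vertex \<Rightarrow> bool) \<Rightarrow> bool" where
  "has_line n k b \<omega> \<longleftrightarrow> (\<exists>i\<in>{1..n}. k \<le> cnt \<omega> (line n b i))"

text \<open>
  Outside a set of vanishing probability, this event alone decides whether the process fills the
  torus or does not move at all.
\<close>

definition seed :: "nat \<Rightarrow> nat \<Rightarrow> nat \<Rightarrow> (vertex \<Rightarrow> bool) \<Rightarrow> bool" where
  "seed n \<theta> k \<omega> \<longleftrightarrow>
     (if odd \<theta> then has_line n k 0 \<omega> \<or> has_line n k 1 \<omega> else has_line n k 0 \<omega> \<and> has_line n k 1 \<omega>)"

definition few_lines :: "nat \<Rightarrow> nat \<Rightarrow> nat \<Rightarrow> nat \<Rightarrow> (vertex \<Rightarrow> bool) \<Rightarrow> bool" where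
  "few_lines n m M b \<omega> \<longleftrightarrow> card {i \<in> {1..n}. m \<le> cnt \<omega> (line n b i)} < M"

definition double_vertex :: "nat \<Rightarrow> nat \<Rightarrow> (vertex \<Rightarrow> bool) \<Rightarrow> bool" where
  "double_vertex n k \<omega> \<longleftrightarrow>
     (\<exists>v\<in>torus n 2. \<omega> v \<and> k \<le> cnt \<omega> (line n 0 (v 0)) \<and> k \<le> cnt \<omega> (line n 1 (v 1)))"

text \<open>
  What is excluded, and why: lines with more than \<open>k\<close> open vertices, because they could trigger
  growth without a seed; a lack of lines with \<open>k - 1\<close> open vertices, because these carry the growth; and
  open vertices on two dense lines, because such a vertex counts for both lines and leaves a dense row
  and a dense column without a closed crossing to start from.
\<close>

definition typical :: "nat \<Rightarrow> nat \<Rightarrow> nat \<Rightarrow> (vertex \<Rightarrow> bool) \<Rightarrow> bool" where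
  "typical n k M \<omega> \<longleftrightarrow>
     (\<forall>b<2. \<not> has_line n (k + 1) b \<omega> \<and> \<not> few_lines n (k - 1) M b \<omega>) \<and> \<not> double_vertex n k \<omega>"

text \<open>
  A full line adds one open vertex to each line across it that has \<open>k - 1\<close> of them, unless the common
  vertex was open from the beginning. The latter spoils at most \<open>k\<close> of the lines, since no line
  starts with more than \<open>k\<close> open vertices.
\<close>

lemma spread:
  assumes typical: "typical n k M \<omega>" and le: "\<And>v. \<omega> v \<Longrightarrow> \<sigma> v" and b: "b < 2" and i: "i \<in> {1..n}"
    and full: "\<And>j. j \<in> {1..n} \<Longrightarrow> \<sigma> (crossing b i j)"
  shows "M - k \<le> card {j \<in> {1..n}. k \<le> cnt \<sigma> (line n (1 - b) j)}"
proof -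
  define J where "J = {j \<in> {1..n}. k - 1 \<le> cnt \<omega> (line n (1 - b) j)}"
  define I where "I = {j \<in> {1..n}. \<omega> (crossing b i j)}"
  have "M \<le> card J"
    using typical b unfolding typical_def few_lines_def J_def by (simp add: not_less)
  moreover have "card I \<le> k"
    using typical b i unfolding I_def cnt_line[OF b i, symmetric]
    by (auto simp: typical_def has_line_def not_le less_Suc_eq_le)
  ultimately have "M - k \<le> card J - card I" by linarith
  also have "\<dots> \<le> card (J - I)"
    by (rule diff_card_le_card_Diff) (simp add: I_def)
  also have "\<dots> \<le> card {j \<in> {1..n}. k \<le> cnt \<sigma> (line n (1 - b) j)}"
  proof (rule card_mono)
    show "J - I \<subseteq> {j \<in> {1..n}. k \<le> cnt \<sigma> (line n (1 - b) j)}"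
    proof
      fix j assume j: "j \<in> J - I"
      let ?L = "{v \<in> line n (1 - b) j. \<omega> v}"
      have jn: "j \<in> {1..n}" using j by (auto simp: J_def)
      have "k \<le> card (insert (crossing b i j) ?L)"
        using j by (auto simp: J_def I_def cnt_def)
      also have "\<dots> \<le> cnt \<sigma> (line n (1 - b) j)"
        unfolding cnt_def using crossing_in_lines[OF b i jn] le full[OF jn]
        by (intro card_mono) auto
      finally show "j \<in> {j \<in> {1..n}. k \<le> cnt \<sigma> (line n (1 - b) j)}" using jn by auto
    qed
  qed simp
  finally show ?thesis .
qed

text \<open>
  All crossings of the two families of lines open up, which gives \<open>\<theta>\<close> open vertices to each of
  \<open>\<theta>\<close> parallel lines.
\<close>

lemma half_filled_grid:
  assumes closed: "closed_config n \<theta> \<sigma>" and b: "b < 2"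
    and J: "\<theta> \<le> card {j \<in> {1..n}. x \<le> cnt \<sigma> (line n (1 - b) j)}"
    and I: "\<theta> \<le> card {i \<in> {1..n}. y \<le> cnt \<sigma> (line n b i)}"
    and xy: "\<theta> \<le> x + y" and v: "v \<in> torus n 2"
  shows "\<sigma> v"
proof (rule all_filled[OF closed _ _ J _ v])
  fix j assume j: "j \<in> {j \<in> {1..n}. x \<le> cnt \<sigma> (line n (1 - b) j)}"
  have "\<sigma> (crossing (1 - b) j i)" if "i \<in> {i \<in> {1..n}. y \<le> cnt \<sigma> (line n b i)}" for i
  proof -
    have "1 - (1 - b) = b" using b by simp
    then show ?thesis
      using that j b xy by (intro crossing_filled[OF closed]) auto
  qed
  then have "card {i \<in> {1..n}. y \<le> cnt \<sigma> (line n b i)} \<le> cnt \<sigma> (line n (1 - b) j)"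
    using j b by (intro card_le_cnt_line) auto
  with I show "\<theta> \<le> cnt \<sigma> (line n (1 - b) j)" by linarith
qed auto

lemma cnt_line_mono: "(\<And>v. \<omega> v \<Longrightarrow> \<sigma> v) \<Longrightarrow> m \<le> cnt \<omega> (line n b i) \<Longrightarrow> m \<le> cnt \<sigma> (line n b i)"
  using cnt_mono[of "line n b i" \<omega> \<sigma>] by auto

text \<open>
  The many lines with \<open>k - 1\<close> open vertices that cross the given line supply what is missing
  at their crossings with it.
\<close>

lemma line_filled_by_cross_lines:
  assumes typical: "typical n k M \<omega>" and M: "\<theta> \<le> M"
    and le: "\<And>v. \<omega> v \<Longrightarrow> \<sigma> v" and closed: "closed_config n \<theta> \<sigma>"
    and b: "b < 2" and i: "i \<in> {1..n}" and cnt: "\<theta> \<le> cnt \<sigma> (line n b i) + (k - 1)"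
    and j: "j \<in> {1..n}"
  shows "\<sigma> (crossing b i j)"
proof (rule line_filled[OF closed b i _ j])
  define J where "J = {j \<in> {1..n}. k - 1 \<le> cnt \<omega> (line n (1 - b) j)}"
  have "\<theta> \<le> card J"
    using typical b M unfolding typical_def few_lines_def J_def by (auto simp: not_less intro: order_trans)
  also have "\<dots> \<le> cnt \<sigma> (line n b i)"
  proof (rule card_le_cnt_line[OF b i])
    fix j assume j: "j \<in> J"
    then have "k - 1 \<le> cnt \<sigma> (line n (1 - b) j)"
      using cnt_line_mono[OF le] by (auto simp: J_def)
    with cnt j show "\<sigma> (crossing b i j)"
      by (intro crossing_filled[OF closed b i]) (auto simp: J_def)
  qed (auto simp: J_def)
  finally show "\<theta> \<le> cnt \<sigma> (line n b i)" .
qed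

text \<open>
  The dense line is filled, since \<open>k + (k - 1) \<ge> \<theta>\<close> at its crossings with lines of \<open>k - 1\<close> open
  vertices. This raises lines across it from \<open>k - 1\<close> to \<open>k\<close>, and their crossings with the lines
  parallel to the dense one that have \<open>k - 1\<close> open vertices again see \<open>\<theta>\<close> open neighbours.
\<close>

lemma odd_percolates:
  assumes typical: "typical n k M \<omega>" and M: "\<theta> + k \<le> M"
    and le: "\<And>v. \<omega> v \<Longrightarrow> \<sigma> v" and closed: "closed_config n \<theta> \<sigma>"
    and b: "b < 2" and hl: "has_line n k b \<omega>" and \<theta>: "\<theta> \<le> k + (k - 1)" and v: "v \<in> torus n 2"
  shows "\<sigma> v"
proof -
  obtain i where i: "i \<in> {1..n}" "k \<le> cnt \<omega> (line n b i)"
    using hl by (auto simp: has_line_def)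
  have "\<sigma> (crossing b i j)" if "j \<in> {1..n}" for j
    using cnt_line_mono[of \<omega> \<sigma>, OF le i(2)] \<theta> M
    by (intro line_filled_by_cross_lines[OF typical _ le closed b i(1) _ that]) auto
  then have "M - k \<le> card {j \<in> {1..n}. k \<le> cnt \<sigma> (line n (1 - b) j)}"
    by (intro spread[OF typical le b i(1)])
  moreover have "M \<le> card {i \<in> {1..n}. k - 1 \<le> cnt \<sigma> (line n b i)}"
  proof -
    have "M \<le> card {i \<in> {1..n}. k - 1 \<le> cnt \<omega> (line n b i)}"
      using typical b by (simp add: typical_def few_lines_def not_less)
    also have "\<dots> \<le> card {i \<in> {1..n}. k - 1 \<le> cnt \<sigma> (line n b i)}"
      using cnt_line_mono[OF le] by (intro card_mono) auto
    finally show ?thesis .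
  qed
  ultimately show ?thesis
    using M \<theta> by (intro half_filled_grid[OF closed b, where x = k and y = "k - 1"] v) linarith+
qed

text \<open>
  A dense row and a dense column meet in a closed vertex, which sees \<open>2 k \<ge> \<theta>\<close> open neighbours. Once
  it is open, both lines have \<open>k + 1\<close> open vertices, enough to be filled with the help of the lines with
  \<open>k - 1\<close>; the two full lines then raise \<open>\<theta>\<close> lines of either direction to \<open>k\<close> open vertices.
\<close>

lemma even_percolates:
  assumes typical: "typical n k M \<omega>" and M: "\<theta> + k \<le> M"
    and le: "\<And>v. \<omega> v \<Longrightarrow> \<sigma> v" and closed: "closed_config n \<theta> \<sigma>"
    and hl: "has_line n k 0 \<omega>" "has_line n k 1 \<omega>"
    and \<theta>: "\<theta> \<le> 2 * k" and v: "v \<in> torus n 2"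
  shows "\<sigma> v"
proof -
  obtain i j where i: "i \<in> {1..n}" "k \<le> cnt \<omega> (line n 0 i)" and j: "j \<in> {1..n}" "k \<le> cnt \<omega> (line n 1 j)"
    using hl by (auto simp: has_line_def)
  let ?x = "crossing 0 i j"
  have x: "?x \<in> line n 0 i" "?x \<in> line n 1 j"
    using crossing_in_lines[of 0 i n j] i j by auto
  have not: "\<not> \<omega> ?x"
    using typical i j x by (auto simp: typical_def double_vertex_def line_def)
  have \<sigma>x: "\<sigma> ?x"
    using cnt_line_mono[of \<omega> \<sigma>, OF le i(2)] cnt_line_mono[of \<omega> \<sigma>, OF le j(2)] \<theta> i j
    by (intro crossing_filled[OF closed]) auto
  have Suc: "Suc k \<le> cnt \<sigma> L" if "finite L" "?x \<in> L" "k \<le> cnt \<omega> L" for L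
  proof -
    have "Suc k \<le> card (insert ?x {v \<in> L. \<omega> v})"
      using that not by (simp add: cnt_def)
    also have "\<dots> \<le> cnt \<sigma> L"
      unfolding cnt_def using that le \<sigma>x by (intro card_mono) auto
    finally show ?thesis .
  qed
  have spread': "M - k \<le> card {j \<in> {1..n}. k \<le> cnt \<sigma> (line n (1 - b) j)}"
    if "b < 2" "l \<in> {1..n}" "Suc k \<le> cnt \<sigma> (line n b l)" for b l
  proof (intro spread[OF typical le that(1,2)])
    fix m assume "m \<in> {1..n}"
    with that \<theta> M show "\<sigma> (crossing b l m)"
      by (intro line_filled_by_cross_lines[OF typical _ le closed that(1,2)]) auto
  qed
  have "M - k \<le> card {j \<in> {1..n}. k \<le> cnt \<sigma> (line n 1 j)}"
    using spread'[of 0 i] Suc[OF _ x(1) i(2)] i by simp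
  moreover have "M - k \<le> card {j \<in> {1..n}. k \<le> cnt \<sigma> (line n 0 j)}"
    using spread'[of 1 j] Suc[OF _ x(2) j(2)] j by simp
  ultimately show ?thesis
    using M \<theta> by (intro half_filled_grid[OF closed, where b = 0 and x = k and y = k] v) auto
qed

text \<open>
  The number \<open>\<theta> + k\<close> of lines with \<open>k - 1\<close> open vertices leaves \<open>\<theta>\<close> of them when up to \<open>k\<close> are
  spoiled by vertices that are open from the beginning.
\<close>

lemma seed_percolates:
  assumes "typical n k (\<theta> + k) \<omega>" "seed n \<theta> k \<omega>" "\<theta> = 2 * k \<or> \<theta> = 2 * k - 1" "v \<in> torus n 2"
  shows "bootstrap_limit n 2 \<theta> \<omega> v"
proof (cases "odd \<theta>")
  case True
  then have "\<theta> = 2 * k - 1" using assms(3) by auto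
  then have \<theta>: "\<theta> \<le> k + (k - 1)" by linarith
  obtain b where "b < 2" "has_line n k b \<omega>"
    using assms(2) True by (auto simp: seed_def intro: that[of 0] that[of 1])
  then show ?thesis
    using odd_percolates[OF assms(1) order_refl bootstrap_limit_ge bootstrap_limit_closed _ _ \<theta> assms(4)]
    by blast
next
  case False
  then show ?thesis
    using assms
    by (intro even_percolates[OF assms(1) order_refl bootstrap_limit_ge bootstrap_limit_closed _ _ _ assms(4)])
       (auto simp: seed_def)
qed

text \<open>
  The two lines through \<open>v\<close> have at most \<open>k\<close> open vertices each, but at least \<open>\<theta>\<close> together: for
  \<open>\<theta> = 2 k\<close> both are dense, and for \<open>\<theta> = 2 k - 1\<close> one of them is.
\<close>

lemma dense_vertex_seed:
  assumes typical: "typical n k M \<omega>" and \<theta>: "\<theta> = 2 * k \<or> (\<theta> = 2 * k - 1 \<and> odd \<theta>)"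
    and v: "v \<in> torus n 2" "\<theta> \<le> open_nbrs n 2 \<omega> v"
  shows "seed n \<theta> k \<omega>"
proof -
  have sum: "\<theta> \<le> cnt \<omega> (line n 0 (v 0)) + cnt \<omega> (line n 1 (v 1))"
    using open_nbrs_le_cnt[OF v(1), of 0 \<omega>] v(2) by simp
  have le: "cnt \<omega> (line n b (v b)) \<le> k" if "b < 2" for b
    using typical that torus_coord[OF v(1) that]
    by (auto simp: typical_def has_line_def not_le less_Suc_eq_le)
  have hl: "has_line n k b \<omega>" if "b < 2" "k \<le> cnt \<omega> (line n b (v b))" for b
    using that torus_coord[OF v(1) that(1)] by (auto simp: has_line_def)
  show ?thesis
  proof (cases "odd \<theta>")
    case True
    with \<theta> have "k \<le> cnt \<omega> (line n 0 (v 0)) \<or> k \<le> cnt \<omega> (line n 1 (v 1))"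
      using sum by auto
    then show ?thesis
      using hl[of 0] hl[of 1] True by (auto simp: seed_def)
  next
    case False
    then have "k \<le> cnt \<omega> (line n 0 (v 0)) \<and> k \<le> cnt \<omega> (line n 1 (v 1))"
      using sum \<theta> le[of 0] le[of 1] by auto
    then show ?thesis
      using hl[of 0] hl[of 1] False by (auto simp: seed_def)
  qed
qed

lemma not_seed_stuck:
  assumes "typical n k M \<omega>" "\<theta> = 2 * k \<or> (\<theta> = 2 * k - 1 \<and> odd \<theta>)" "\<not> seed n \<theta> k \<omega>"
  shows "bootstrap_limit n 2 \<theta> \<omega> = \<omega>"
  using dense_vertex_seed[OF assms(1,2)] assms(3)
  by (intro bootstrap_limit_stuck) (auto simp: not_le[symmetric])

lemma typical_no_full_line:
  assumes "typical n k M \<omega>" "k < n" "b < 2" "i \<in> {1..n}"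
  shows "\<exists>v\<in>line n b i. \<not> \<omega> v"
proof (rule ccontr)
  assume "\<not> ?thesis"
  then have "{v \<in> line n b i. \<omega> v} = line n b i" by auto
  then have "cnt \<omega> (line n b i) = n"
    using assms card_line by (simp add: cnt_def)
  then have "has_line n (k + 1) b \<omega>"
    using assms by (auto simp: has_line_def intro!: bexI[of _ i])
  then show False
    using assms by (auto simp: typical_def)
qed

text \<open>
  A seed fills the torus, hence a line; a line can only be filled if the process moves, since no line
  is full at the beginning; and it only moves if some vertex sees \<open>\<theta>\<close> open neighbours, which requires a
  seed. So the events behind the three critical values coincide on typical configurations.
\<close>

lemma seed_iff:
  assumes typical: "typical n k (\<theta> + k) \<omega>" and \<theta>: "\<theta> = 2 * k \<or> (\<theta> = 2 * k - 1 \<and> odd \<theta>)" and n: "k < n"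
  shows "(\<forall>v\<in>torus n 2. bootstrap_limit n 2 \<theta> \<omega> v) \<longleftrightarrow> seed n \<theta> k \<omega>"
    and "(\<exists>b<2. \<exists>i\<in>{1..n}. \<forall>v\<in>line n b i. bootstrap_limit n 2 \<theta> \<omega> v) \<longleftrightarrow> seed n \<theta> k \<omega>"
    and "(\<exists>v\<in>torus n 2. \<theta> \<le> open_nbrs n 2 \<omega> v) \<longleftrightarrow> seed n \<theta> k \<omega>"
proof -
  let ?full = "\<forall>v\<in>torus n 2. bootstrap_limit n 2 \<theta> \<omega> v"
  let ?line = "\<exists>b<2. \<exists>i\<in>{1..n}. \<forall>v\<in>line n b i. bootstrap_limit n 2 \<theta> \<omega> v"
  let ?dense = "\<exists>v\<in>torus n 2. \<theta> \<le> open_nbrs n 2 \<omega> v"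
  have 1: ?full if "seed n \<theta> k \<omega>"
    using seed_percolates[OF typical that] \<theta> by blast
  have 2: ?line if ?full
  proof (intro exI[of _ 0] conjI bexI[of _ 1] ballI)
    fix v assume "v \<in> line n 0 1"
    then have "v \<in> torus n 2" using line_subset by blast
    with that show "bootstrap_limit n 2 \<theta> \<omega> v" by blast
  qed (use n in auto)
  have 3: ?dense if filled: ?line
  proof (rule ccontr)
    assume "\<not> ?dense"
    then have stuck: "bootstrap_limit n 2 \<theta> \<omega> = \<omega>"
      by (intro bootstrap_limit_stuck) (auto simp: not_le)
    obtain b i where "b < 2" "i \<in> {1..n}" "\<forall>v\<in>line n b i. \<omega> v"
      using filled unfolding stuck by blast
    with typical_no_full_line[OF typical n] show False by blast
  qed
  have 4: "seed n \<theta> k \<omega>" if ?dense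
    using that dense_vertex_seed[OF typical \<theta>] by blast
  from 1 2 3 4 show "?full \<longleftrightarrow> seed n \<theta> k \<omega>" "?line \<longleftrightarrow> seed n \<theta> k \<omega>" "?dense \<longleftrightarrow> seed n \<theta> k \<omega>"
    by blast+
qed

lemma subgraphs_2_2: "n \<ge> 1 \<Longrightarrow> subgraphs n 2 2 = {torus n 2}"
proof -
  assume n: "n \<ge> 1"
  have "I = {..<2}" if "I \<subseteq> {..<2::nat}" "card I = 2" for I
    using that by (intro card_subset_eq) auto
  moreover have "crossing 0 1 1 \<in> torus n 2"
    using n by (intro crossing_in_torus) auto
  ultimately have "I \<subseteq> {..<2} \<and> card I = 2 \<and> u \<in> torus n 2 \<longleftrightarrow> I = {..<2} \<and> u \<in> torus n 2"
    for I :: "nat set" and u :: vertex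
    by auto
  then have "subgraphs n 2 2 = {{v \<in> torus n 2. \<forall>j\<in>{..<2} - I. v j = u j} | I u. I = {..<2} \<and> u \<in> torus n 2}"
    unfolding subgraphs_def by simp
  also have "\<dots> = {torus n 2}"
    using \<open>crossing 0 1 1 \<in> torus n 2\<close> by auto
  finally show ?thesis .
qed

lemma Ex_subgraph_1:
  "(\<exists>F\<in>subgraphs n 2 1. P F) \<longleftrightarrow> (\<exists>b<2. \<exists>i\<in>{1..n}. P (line n b i))"
proof
  assume "\<exists>F\<in>subgraphs n 2 1. P F"
  then obtain I u where I: "I \<subseteq> {..<2}" "card I = 1" "u \<in> torus n 2"
    and P: "P {v \<in> torus n 2. \<forall>j\<in>{..<2} - I. v j = u j}"
    by (auto simp: subgraphs_def)
  obtain c where c: "I = {c}" using I(2) by (auto simp: card_1_singleton_iff)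
  then have "c < 2" using I(1) by auto
  then have "c = 0 \<or> c = 1" by linarith
  then have "{..<2} - I = {1 - c}" using c by (auto simp: lessThan_2)
  then have "P (line n (1 - c) (u (1 - c)))"
    using P by (simp add: line_def)
  then show "\<exists>b<2. \<exists>i\<in>{1..n}. P (line n b i)"
    using \<open>c < 2\<close> torus_coord[OF I(3), of "1 - c"] by (intro exI[of _ "1 - c"]) auto
next
  assume "\<exists>b<2. \<exists>i\<in>{1..n}. P (line n b i)"
  then obtain b i where b: "b < 2" and i: "i \<in> {1..n}" and P: "P (line n b i)" by blast
  have "b = 0 \<or> b = 1" using b by linarith
  then have "{..<2} - {1 - b} = {b}" by (auto simp: lessThan_2)
  then have eq: "line n b i = {v \<in> torus n 2. \<forall>j\<in>{..<2} - {1 - b}. v j = crossing b i i j}"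
    using b by (auto simp: line_def)
  have "line n b i \<in> subgraphs n 2 1"
    unfolding subgraphs_def eq using b i crossing_in_torus[OF i i, of b]
    by (intro CollectI exI[of _ "{1 - b}"] exI[of _ "crossing b i i"]) auto
  then show "\<exists>F\<in>subgraphs n 2 1. P F" using P by blast
qed

section \<open>Probabilities of dense lines\<close>

lemma increasing_has_line: "increasing (has_line n m b)"
proof (rule increasingI)
  fix \<omega> \<omega>' :: "vertex \<Rightarrow> bool"
  assume "has_line n m b \<omega>" and le: "\<And>v. \<omega> v \<Longrightarrow> \<omega>' v"
  then obtain i where "i \<in> {1..n}" "m \<le> cnt \<omega> (line n b i)"
    unfolding has_line_def by blast
  moreover have "cnt \<omega> (line n b i) \<le> cnt \<omega>' (line n b i)"
    by (rule cnt_mono) (simp, rule le)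
  ultimately show "has_line n m b \<omega>'"
    unfolding has_line_def by (meson order_trans)
qed

lemma depends_on_cnt: "depends_on A (\<lambda>\<omega>. m \<le> cnt \<omega> A)"
  unfolding depends_on_def
proof (intro allI impI)
  fix \<omega> \<omega>' :: "'a \<Rightarrow> bool" assume "\<forall>x\<in>A. \<omega> x = \<omega>' x"
  then have "{x \<in> A. \<omega> x} = {x \<in> A. \<omega>' x}" by auto
  then show "(m \<le> cnt \<omega> A) = (m \<le> cnt \<omega>' A)" by (simp add: cnt_def)
qed

lemma depends_on_not: "depends_on A E \<Longrightarrow> depends_on A (\<lambda>\<omega>. \<not> E \<omega>)"
  unfolding depends_on_def by blast

lemma cnt_prob_le:
  assumes "finite X" "0 \<le> p" "p \<le> 1" "A \<subseteq> X"
  shows "bprob X p (\<lambda>\<omega>. m \<le> cnt \<omega> A) \<le> real (card A choose m) * p ^ m"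
proof -
  define K where "K = {S. S \<subseteq> A \<and> card S = m}"
  have fin: "finite A" using assms finite_subset by blast
  have "bprob X p (\<lambda>\<omega>. m \<le> cnt \<omega> A) \<le> bprob X p (\<lambda>\<omega>. \<exists>S\<in>K. \<forall>x\<in>S. \<omega> x)"
  proof (rule bprob_mono)
    fix \<omega> assume "m \<le> cnt \<omega> A"
    then obtain S where "S \<subseteq> {x \<in> A. \<omega> x}" "card S = m"
      unfolding cnt_def by (meson obtain_subset_with_card_n)
    then show "\<exists>S\<in>K. \<forall>x\<in>S. \<omega> x" unfolding K_def by blast
  qed
  also have "\<dots> \<le> real (card K) * p ^ m"
    using assms fin by (intro bprob_some_set_open) (auto simp: K_def)
  also have "card K = card A choose m"
    unfolding K_def by (rule n_subsets[OF fin])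
  finally show ?thesis .
qed

text \<open>
  The number of open vertices in \<open>A\<close> is binomially distributed, and the left-hand side is the probability
  that it equals \<open>m\<close>.
\<close>

lemma cnt_prob_ge:
  assumes "finite X" "0 \<le> p" "p \<le> 1" "A \<subseteq> X"
  shows "real (card A choose m) * p ^ m * (1 - p) ^ (card A - m) \<le> bprob X p (\<lambda>\<omega>. m \<le> cnt \<omega> A)"
proof -
  let ?M = "\<lambda>X. Pi_pmf X False (\<lambda>_. bernoulli_pmf p)"
  have fin: "finite A" using assms finite_subset by blast
  have "binomial_pmf (card A) p = map_pmf (\<lambda>\<omega>. cnt \<omega> A) (?M A)"
    using assms fin by (simp add: binomial_pmf_altdef'[where A = A and dflt = False] cnt_def)
  also have "?M A = map_pmf (\<lambda>\<omega> x. if x \<in> A then \<omega> x else False) (?M X)"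
    using assms by (intro Pi_pmf_subset) auto
  also have "map_pmf (\<lambda>\<omega>. cnt \<omega> A) \<dots> = map_pmf (\<lambda>\<omega>. cnt \<omega> A) (?M X)"
    by (simp add: pmf.map_comp o_def cnt_def cong: conj_cong)
  finally have eq: "binomial_pmf (card A) p = map_pmf (\<lambda>\<omega>. cnt \<omega> A) (?M X)" .
  have "real (card A choose m) * p ^ m * (1 - p) ^ (card A - m) = pmf (binomial_pmf (card A) p) m"
    using assms by simp
  also have "\<dots> \<le> measure_pmf.prob (binomial_pmf (card A) p) {m..}"
    unfolding pmf.rep_eq by (intro measure_pmf.finite_measure_mono) auto
  also have "\<dots> = bprob X p (\<lambda>\<omega>. m \<le> cnt \<omega> A)"
    unfolding eq by (simp add: bprob_def vimage_def)
  finally show ?thesis .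
qed

text \<open>
  The lower bound above for a line. Together with the union bound \<open>(n choose m) p\<^sup>m\<close> it determines the
  asymptotic probability of at least \<open>m\<close> open vertices on a line.
\<close>

definition dense_prob_lb :: "nat \<Rightarrow> real \<Rightarrow> nat \<Rightarrow> real" where
  "dense_prob_lb n p m = real (n choose m) * p ^ m * (1 - p) ^ (n - m)"

text \<open>
  Parallel lines are disjoint, hence independent.
\<close>

lemma lines_sparse_prob:
  assumes "0 \<le> p" "p \<le> 1" "b < 2" "J \<subseteq> {1..n}"
  shows "bprob (torus n 2) p (\<lambda>\<omega>. \<forall>i\<in>J. \<not> m \<le> cnt \<omega> (line n b i)) \<le> (1 - dense_prob_lb n p m) ^ card J"
    and "real (n choose m) * p ^ m \<le> 1 \<Longrightarrow> (1 - real (n choose m) * p ^ m) ^ card J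
      \<le> bprob (torus n 2) p (\<lambda>\<omega>. \<forall>i\<in>J. \<not> m \<le> cnt \<omega> (line n b i))"
proof -
  define q where "q i = bprob (torus n 2) p (\<lambda>\<omega>. m \<le> cnt \<omega> (line n b i))" for i
  have finJ: "finite J" using assms(4) finite_subset by blast
  have prod: "bprob (torus n 2) p (\<lambda>\<omega>. \<forall>i\<in>J. \<not> m \<le> cnt \<omega> (line n b i)) = (\<Prod>i\<in>J. 1 - q i)"
  proof -
    have "disjoint_family_on (line n b) J"
      by (auto simp: disjoint_family_on_def line_def)
    then show ?thesis
      unfolding q_def bprob_not[symmetric]
      by (rule bprob_Ball_indep[OF finite_torus assms(1,2) finJ])
        (rule depends_on_not, rule depends_on_cnt)
  qed
  have lb: "dense_prob_lb n p m \<le> q i" and ub: "q i \<le> real (n choose m) * p ^ m" if "i \<in> J" for i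
  proof -
    have "card (line n b i) = n" using that assms by (intro card_line) auto
    then show "dense_prob_lb n p m \<le> q i" "q i \<le> real (n choose m) * p ^ m"
      unfolding q_def dense_prob_lb_def
      using cnt_prob_ge[OF finite_torus assms(1,2) line_subset, of n b i m]
        cnt_prob_le[OF finite_torus assms(1,2) line_subset, of n m b i] by simp_all
  qed
  have "(\<Prod>i\<in>J. 1 - q i) \<le> (\<Prod>i\<in>J. 1 - dense_prob_lb n p m)"
    using lb by (intro prod_mono) (auto simp: q_def)
  then show "bprob (torus n 2) p (\<lambda>\<omega>. \<forall>i\<in>J. \<not> m \<le> cnt \<omega> (line n b i)) \<le> (1 - dense_prob_lb n p m) ^ card J"
    unfolding prod by simp
  assume "real (n choose m) * p ^ m \<le> 1"
  then have "(\<Prod>i\<in>J. 1 - real (n choose m) * p ^ m) \<le> (\<Prod>i\<in>J. 1 - q i)"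
    using ub by (intro prod_mono) auto
  then show "(1 - real (n choose m) * p ^ m) ^ card J
      \<le> bprob (torus n 2) p (\<lambda>\<omega>. \<forall>i\<in>J. \<not> m \<le> cnt \<omega> (line n b i))"
    unfolding prod by simp
qed

lemma has_line_prob:
  assumes "0 \<le> p" "p \<le> 1" "b < 2"
  shows "1 - (1 - dense_prob_lb n p m) ^ n \<le> bprob (torus n 2) p (has_line n m b)"
    and "real (n choose m) * p ^ m \<le> 1 \<Longrightarrow>
      bprob (torus n 2) p (has_line n m b) \<le> 1 - (1 - real (n choose m) * p ^ m) ^ n"
proof -
  have "bprob (torus n 2) p (has_line n m b)
      = 1 - bprob (torus n 2) p (\<lambda>\<omega>. \<forall>i\<in>{1..n}. \<not> m \<le> cnt \<omega> (line n b i))"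
    using bprob_not[of "torus n 2" p "has_line n m b"] by (simp add: has_line_def)
  then show "1 - (1 - dense_prob_lb n p m) ^ n \<le> bprob (torus n 2) p (has_line n m b)"
    "real (n choose m) * p ^ m \<le> 1 \<Longrightarrow>
      bprob (torus n 2) p (has_line n m b) \<le> 1 - (1 - real (n choose m) * p ^ m) ^ n"
    using lines_sparse_prob[OF assms, of "{1..n}" n m] by simp_all
qed

lemma binomial_le_power: "n choose m \<le> n ^ m"
  by (cases "m \<le> n") (auto intro: binomial_le_pow simp: binomial_eq_0)

lemma has_line_prob_crude:
  assumes "0 \<le> p" "p \<le> 1" "b < 2"
  shows "bprob (torus n 2) p (has_line n m b) \<le> real n ^ (m + 1) * p ^ m"
proof -
  have "bprob (torus n 2) p (has_line n m b)
      \<le> (\<Sum>i\<in>{1..n}. bprob (torus n 2) p (\<lambda>\<omega>. m \<le> cnt \<omega> (line n b i)))"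
    unfolding has_line_def by (rule bprob_Bex_le) simp
  also have "\<dots> \<le> (\<Sum>i\<in>{1..n}. real (n ^ m) * p ^ m)"
  proof (rule sum_mono)
    fix i assume i: "i \<in> {1..n}"
    have "bprob (torus n 2) p (\<lambda>\<omega>. m \<le> cnt \<omega> (line n b i)) \<le> real (n choose m) * p ^ m"
      using cnt_prob_le[OF finite_torus assms(1,2) line_subset, of n m b i] card_line[OF assms(3) i] by simp
    also have "\<dots> \<le> real (n ^ m) * p ^ m"
      using assms binomial_le_power[of n m] by (intro mult_right_mono) (simp_all only: of_nat_le_iff zero_le_power)
    finally show "bprob (torus n 2) p (\<lambda>\<omega>. m \<le> cnt \<omega> (line n b i)) \<le> real (n ^ m) * p ^ m" .
  qed
  finally show ?thesis by simp
qed

text \<open>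
  If fewer than \<open>M\<close> lines have \<open>m\<close> open vertices, then there are \<open>n - M\<close> lines that all fail to;
  the factor \<open>n\<^sup>M\<close> bounds the number of ways to choose these.
\<close>

lemma few_lines_prob:
  assumes "0 \<le> p" "p \<le> 1" "b < 2" "M \<le> n"
  shows "bprob (torus n 2) p (few_lines n m M b) \<le> real n ^ M * (1 - dense_prob_lb n p m) ^ (n - M)"
proof -
  define K where "K = {J. J \<subseteq> {1..n} \<and> card J = n - M}"
  have finK: "finite K" unfolding K_def by (rule finite_subset[of _ "Pow {1..n}"]) auto
  have "bprob (torus n 2) p (few_lines n m M b)
      \<le> bprob (torus n 2) p (\<lambda>\<omega>. \<exists>J\<in>K. \<forall>i\<in>J. \<not> m \<le> cnt \<omega> (line n b i))"
  proof (rule bprob_mono)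
    fix \<omega> assume few: "few_lines n m M b \<omega>"
    let ?D = "{i \<in> {1..n}. m \<le> cnt \<omega> (line n b i)}"
    have "n - M \<le> card ({1..n} - ?D)"
      using few diff_card_le_card_Diff[of ?D "{1..n}"] by (simp add: few_lines_def)
    then obtain J where "J \<subseteq> {1..n} - ?D" "card J = n - M"
      by (meson obtain_subset_with_card_n)
    then show "\<exists>J\<in>K. \<forall>i\<in>J. \<not> m \<le> cnt \<omega> (line n b i)"
      unfolding K_def by (intro bexI[of _ J]) auto
  qed
  also have "\<dots> \<le> (\<Sum>J\<in>K. bprob (torus n 2) p (\<lambda>\<omega>. \<forall>i\<in>J. \<not> m \<le> cnt \<omega> (line n b i)))"
    by (rule bprob_Bex_le[OF finK])
  also have "\<dots> \<le> (\<Sum>J\<in>K. (1 - dense_prob_lb n p m) ^ (n - M))"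
  proof (rule sum_mono)
    fix J assume "J \<in> K"
    then show "bprob (torus n 2) p (\<lambda>\<omega>. \<forall>i\<in>J. \<not> m \<le> cnt \<omega> (line n b i))
        \<le> (1 - dense_prob_lb n p m) ^ (n - M)"
      using lines_sparse_prob(1)[OF assms(1-3), of J n m] by (simp add: K_def)
  qed
  also have "\<dots> = real (n choose M) * (1 - dense_prob_lb n p m) ^ (n - M)"
    using assms(4) n_subsets[of "{1..n}" "n - M"] binomial_symmetric[of M n] by (simp add: K_def)
  also have "\<dots> \<le> real (n ^ M) * (1 - dense_prob_lb n p m) ^ (n - M)"
  proof (rule mult_right_mono)
    have "dense_prob_lb n p m \<le> 1"
    proof -
      have "pmf (binomial_pmf n p) m \<le> 1" by (rule pmf_le_1)
      then show ?thesis using assms by (simp add: dense_prob_lb_def)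
    qed
    then show "0 \<le> (1 - dense_prob_lb n p m) ^ (n - M)" by simp
  qed (simp only: of_nat_le_iff binomial_le_power)
  finally show ?thesis by simp
qed

text \<open>
  The vertex and \<open>k - 1\<close> others on each of its two lines are \<open>2 k - 1\<close> open vertices; there are \<open>n\<^sup>2\<close>
  choices of the vertex and at most \<open>n\<close> to the power \<open>k - 1\<close> for either line.
\<close>

lemma double_vertex_prob:
  assumes "0 \<le> p" "p \<le> 1" "1 \<le> k"
  shows "bprob (torus n 2) p (double_vertex n k) \<le> real n ^ (2 * k) * p ^ (2 * k - 1)"
proof -
  define side where "side b v = line n b (v b) - {v}" for b v
  define sub where "sub b v = {S. S \<subseteq> side b v \<and> card S = k - 1}" for b v
  define I where "I = (SIGMA v : torus n 2. sub 0 v \<times> sub 1 v)"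
  define K where "K = (\<lambda>(v, S, T). insert v (S \<union> T)) ` I"
  have fin: "finite (side b v)" for b v by (simp add: side_def)
  have finsub: "finite (sub b v)" for b v
    unfolding sub_def by (rule finite_subset[of _ "Pow (side b v)"]) (use fin in auto)
  have card_sub: "card (sub b v) \<le> n ^ (k - 1)" if "v \<in> torus n 2" "b < 2" for b v
  proof -
    have "card (sub b v) = card (side b v) choose (k - 1)"
      unfolding sub_def by (rule n_subsets[OF fin])
    also have "\<dots> \<le> card (side b v) ^ (k - 1)" by (rule binomial_le_power)
    also have "card (side b v) \<le> n"
      using card_line[OF that(2) torus_coord[OF that]] card_mono[of "line n b (v b)" "side b v"]
      by (auto simp: side_def)
    finally show ?thesis by (simp add: power_mono)
  qed
  have finI: "finite I" unfolding I_def using finsub by auto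
  have card_I: "card I \<le> n ^ (2 * k)"
  proof -
    have "card I = (\<Sum>v\<in>torus n 2. card (sub 0 v) * card (sub 1 v))"
      unfolding I_def using finsub by (simp add: card_SigmaI card_cartesian_product)
    also have "\<dots> \<le> (\<Sum>v\<in>torus n 2. n ^ (k - 1) * n ^ (k - 1))"
      by (intro sum_mono mult_mono card_sub) auto
    also have "\<dots> = n ^ 2 * (n ^ (k - 1) * n ^ (k - 1))"
      by (simp add: torus_def card_PiE)
    also have "\<dots> = n ^ (2 + (k - 1) + (k - 1))" by (simp only: power_add mult.assoc)
    also have "2 + (k - 1) + (k - 1) = 2 * k" using assms(3) by simp
    finally show ?thesis .
  qed
  have "bprob (torus n 2) p (double_vertex n k) \<le> bprob (torus n 2) p (\<lambda>\<omega>. \<exists>S\<in>K. \<forall>x\<in>S. \<omega> x)"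
  proof (rule bprob_mono)
    fix \<omega> assume "double_vertex n k \<omega>"
    then obtain v where v: "v \<in> torus n 2" "\<omega> v"
      and cnt: "k \<le> cnt \<omega> (line n 0 (v 0))" "k \<le> cnt \<omega> (line n 1 (v 1))"
      by (auto simp: double_vertex_def)
    have "\<exists>S\<in>sub b v. \<forall>x\<in>S. \<omega> x" if "k \<le> cnt \<omega> (line n b (v b))" for b
    proof -
      have "{x \<in> side b v. \<omega> x} = {x \<in> line n b (v b). \<omega> x} - {v}"
        by (auto simp: side_def)
      moreover have "v \<in> {x \<in> line n b (v b). \<omega> x}" using v by (simp add: line_def)
      ultimately have "k - 1 \<le> card {x \<in> side b v. \<omega> x}"
        using that by (simp add: cnt_def card_Diff_singleton)
      then obtain S where "S \<subseteq> {x \<in> side b v. \<omega> x}" "card S = k - 1"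
        by (meson obtain_subset_with_card_n)
      then show ?thesis unfolding sub_def by (intro bexI[of _ S]) auto
    qed
    from this[OF cnt(1)] this[OF cnt(2)] obtain S T where
      "S \<in> sub 0 v" "T \<in> sub 1 v" and op: "\<forall>x\<in>S. \<omega> x" "\<forall>x\<in>T. \<omega> x" by blast
    then have "insert v (S \<union> T) \<in> K"
      unfolding K_def I_def using v by (intro image_eqI[of _ _ "(v, S, T)"]) auto
    moreover have "\<forall>x\<in>insert v (S \<union> T). \<omega> x" using op v(2) by (simp add: ball_Un)
    ultimately show "\<exists>S\<in>K. \<forall>x\<in>S. \<omega> x" by (rule bexI[rotated])
  qed
  also have "\<dots> \<le> real (card K) * p ^ (2 * k - 1)"
  proof (rule bprob_some_set_open)
    show "finite K" unfolding K_def using finI by simp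
    fix U assume "U \<in> K"
    then obtain t where t: "t \<in> I" "U = (case t of (v, S, T) \<Rightarrow> insert v (S \<union> T))"
      unfolding K_def by (elim imageE)
    obtain v S T where vST: "t = (v, S, T)" by (cases t)
    have U: "U = insert v (S \<union> T)" and v: "v \<in> torus n 2"
      and S: "S \<subseteq> side 0 v" "card S = k - 1" and T: "T \<subseteq> side 1 v" "card T = k - 1"
      using t by (simp_all add: vST I_def sub_def)
    have "side 0 v \<inter> side 1 v = {}"
    proof -
      have meet: "x = crossing 0 (v 0) (v 1)" if "x \<in> line n 0 (v 0)" "x \<in> line n 1 (v 1)" for x
        by (rule line_Int_line) (use that in simp_all)
      have self: "v \<in> line n 0 (v 0)" "v \<in> line n 1 (v 1)" using v by (simp_all add: line_def)
      have "x = v" if "x \<in> line n 0 (v 0)" "x \<in> line n 1 (v 1)" for x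
        by (rule trans[OF meet[OF that] meet[OF self, symmetric]])
      then show ?thesis unfolding side_def by blast
    qed
    then have disj: "S \<inter> T = {}" using S T by blast
    have finST: "finite S" "finite T" by (rule finite_subset[OF S(1) fin], rule finite_subset[OF T(1) fin])
    have "v \<notin> S \<union> T" using S T by (auto simp: side_def)
    then have "card U = 1 + (k - 1 + (k - 1))"
      using finST disj S T by (simp add: U card_Un_disjoint)
    then have "card U = 2 * k - 1" using assms(3) by simp
    moreover have side: "side b v \<subseteq> torus n 2" for b
      using line_subset[of n b "v b"] by (auto simp: side_def)
    have "U \<subseteq> torus n 2"
      unfolding U using v order_trans[OF S(1) side] order_trans[OF T(1) side] by simp
    ultimately show "U \<subseteq> torus n 2 \<and> card U = 2 * k - 1" by blast
  qed (use assms in auto)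
  also have "\<dots> \<le> real (n ^ (2 * k)) * p ^ (2 * k - 1)"
  proof (rule mult_right_mono)
    show "real (card K) \<le> real (n ^ (2 * k))"
      using card_image_le[OF finI, of "\<lambda>(v, S, T). insert v (S \<union> T)"] card_I
      unfolding K_def of_nat_le_iff by (rule order_trans)
  qed (use assms in simp)
  finally show ?thesis by simp
qed

text \<open>
  Rows and columns share vertices, so their independence holds only asymptotically: one bound is the
  Harris inequality; for the other, a dense row and a dense column with a closed crossing occur
  disjointly, and the van den Berg-Kesten inequality applies.
\<close>

lemma both_has_line_prob:
  fixes n k :: nat
  assumes "0 \<le> p" "p \<le> 1 / 2"
  defines "P \<equiv> bprob (torus n 2) p"
  shows "P (has_line n k 0) * P (has_line n k 1) \<le> P (\<lambda>\<omega>. has_line n k 0 \<omega> \<and> has_line n k 1 \<omega>)"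
    and "P (\<lambda>\<omega>. has_line n k 0 \<omega> \<and> has_line n k 1 \<omega>)
      \<le> P (has_line n k 0) * P (has_line n k 1) + P (double_vertex n k)"
proof -
  show "P (has_line n k 0) * P (has_line n k 1) \<le> P (\<lambda>\<omega>. has_line n k 0 \<omega> \<and> has_line n k 1 \<omega>)"
    unfolding P_def using assms by (intro bprob_harris increasing_has_line) auto
  have "P (\<lambda>\<omega>. has_line n k 0 \<omega> \<and> has_line n k 1 \<omega>)
      \<le> P (\<lambda>\<omega>. disj_occ (has_line n k 0) (has_line n k 1) \<omega> \<or> double_vertex n k \<omega>)"
    unfolding P_def
  proof (rule bprob_mono)
    fix \<omega> assume "has_line n k 0 \<omega> \<and> has_line n k 1 \<omega>"
    then obtain i j where i: "i \<in> {1..n}" "k \<le> cnt \<omega> (line n 0 i)"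
      and j: "j \<in> {1..n}" "k \<le> cnt \<omega> (line n 1 j)"
      by (auto simp: has_line_def)
    show "disj_occ (has_line n k 0) (has_line n k 1) \<omega> \<or> double_vertex n k \<omega>"
    proof (cases "\<omega> (crossing 0 i j)")
      case True
      have "crossing 0 i j \<in> line n 0 i" "crossing 0 i j \<in> line n 1 j"
        using crossing_in_lines[of 0 i n j] i j by auto
      then have "double_vertex n k \<omega>"
        unfolding double_vertex_def using True i j
        by (intro bexI[of _ "crossing 0 i j"]) (auto simp: line_def)
      then show ?thesis ..
    next
      case False
      \<comment> \<open>The two lines meet only in the closed crossing, so their open vertices are disjoint witnesses.\<close>
      define \<sigma> where "\<sigma> v \<longleftrightarrow> v \<in> line n 0 i \<and> \<omega> v" for v
      define \<tau> where "\<tau> v \<longleftrightarrow> v \<in> line n 1 j \<and> \<omega> v" for v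
      have "{v \<in> line n 0 i. \<sigma> v} = {v \<in> line n 0 i. \<omega> v}" "{v \<in> line n 1 j. \<tau> v} = {v \<in> line n 1 j. \<omega> v}"
        by (auto simp: \<sigma>_def \<tau>_def)
      then have "k \<le> cnt \<sigma> (line n 0 i)" "k \<le> cnt \<tau> (line n 1 j)"
        using i(2) j(2) by (simp_all only: cnt_def)
      then have "has_line n k 0 \<sigma>" "has_line n k 1 \<tau>"
        unfolding has_line_def using i(1) j(1) by blast+
      moreover have "\<not> (\<sigma> v \<and> \<tau> v)" for v
        using line_Int_line[of 0 v n i j] False by (auto simp: \<sigma>_def \<tau>_def)
      ultimately have "disj_occ (has_line n k 0) (has_line n k 1) \<omega>"
        unfolding disj_occ_def
        by (intro exI[of _ \<sigma>] exI[of _ \<tau>]) (auto simp: \<sigma>_def \<tau>_def le_fun_def)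
      then show ?thesis ..
    qed
  qed
  also have "\<dots> \<le> P (disj_occ (has_line n k 0) (has_line n k 1)) + P (double_vertex n k)"
    unfolding P_def by (rule bprob_disj_le)
  also have "P (disj_occ (has_line n k 0) (has_line n k 1)) \<le> P (has_line n k 0) * P (has_line n k 1)"
    unfolding P_def using assms by (intro bprob_bk increasing_has_line) auto
  finally show "P (\<lambda>\<omega>. has_line n k 0 \<omega> \<and> has_line n k 1 \<omega>)
      \<le> P (has_line n k 0) * P (has_line n k 1) + P (double_vertex n k)" by simp
qed

lemma not_typical_prob:
  assumes "0 \<le> p" "p \<le> 1" "1 \<le> k" "M \<le> n"
  shows "bprob (torus n 2) p (\<lambda>\<omega>. \<not> typical n k M \<omega>) \<le>
    2 * (real n ^ (k + 2) * p ^ (k + 1))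
    + 2 * (real n ^ M * (1 - dense_prob_lb n p (k - 1)) ^ (n - M))
    + real n ^ (2 * k) * p ^ (2 * k - 1)"
proof -
  let ?P = "bprob (torus n 2) p"
  let ?bad = "\<lambda>b \<omega>. has_line n (k + 1) b \<omega> \<or> few_lines n (k - 1) M b \<omega>"
  have bad: "?P (?bad b) \<le>
      real n ^ (k + 2) * p ^ (k + 1) + real n ^ M * (1 - dense_prob_lb n p (k - 1)) ^ (n - M)" if "b < 2" for b
    using bprob_disj_le[of "torus n 2" p "has_line n (k + 1) b" "few_lines n (k - 1) M b"]
      has_line_prob_crude[OF assms(1,2) that, of n "k + 1"]
      few_lines_prob[OF assms(1,2) that assms(4), of "k - 1"] by simp
  have "\<not> typical n k M \<omega> \<longleftrightarrow> (?bad 0 \<omega> \<or> ?bad 1 \<omega>) \<or> double_vertex n k \<omega>" for \<omega>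
    by (auto simp: typical_def less_2_cases_iff)
  then have "?P (\<lambda>\<omega>. \<not> typical n k M \<omega>)
      = ?P (\<lambda>\<omega>. (?bad 0 \<omega> \<or> ?bad 1 \<omega>) \<or> double_vertex n k \<omega>)"
    by simp
  also have "\<dots> \<le> ?P (\<lambda>\<omega>. ?bad 0 \<omega> \<or> ?bad 1 \<omega>) + ?P (double_vertex n k)"
    by (rule bprob_disj_le)
  also have "?P (\<lambda>\<omega>. ?bad 0 \<omega> \<or> ?bad 1 \<omega>) \<le> ?P (?bad 0) + ?P (?bad 1)"
    by (rule bprob_disj_le)
  finally show ?thesis
    using bad[of 0] bad[of 1] double_vertex_prob[OF assms(1-3), of n] by simp
qed

section \<open>Limits at the critical scale\<close>

lemma binomial_over_power_limit: "(\<lambda>n. real (n choose m) / real n ^ m) \<longlonglongrightarrow> 1 / fact m"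
proof (rule Lim_transform_eventually)
  have "(\<lambda>n. (real n - real i) / real n) \<longlonglongrightarrow> 1" for i
    by real_asymp
  then have "(\<lambda>n. (\<Prod>i = 0..<m. (real n - real i) / real n) / fact m) \<longlonglongrightarrow> (\<Prod>i = 0..<m. 1) / fact m"
    by (intro tendsto_divide tendsto_prod tendsto_const) simp_all
  then show "(\<lambda>n. (\<Prod>i = 0..<m. (real n - real i) / real n) / fact m) \<longlonglongrightarrow> 1 / fact m" by simp
  show "\<forall>\<^sub>F n in sequentially. (\<Prod>i = 0..<m. (real n - real i) / real n) / fact m = real (n choose m) / real n ^ m"
    by (simp add: binomial_gbinomial gbinomial_prod_rev prod_dividef)
qed

lemma powr_neg_limit: "0 < e \<Longrightarrow> (\<lambda>n. real n powr (- e)) \<longlonglongrightarrow> 0"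
  by (rule tendsto_neg_powr) (auto simp: filterlim_real_sequentially)

text \<open>
  Since \<open>x\<close> tends to 0, the logarithm \<open>n ln (1 - x n)\<close> eventually differs from
  \<open>- n x n\<close> by at most \<open>2 n (x n)\<^sup>2\<close>, which tends to 0.
\<close>

lemma one_minus_power_limit:
  fixes x :: "nat \<Rightarrow> real"
  assumes lim: "(\<lambda>n. real n * x n) \<longlonglongrightarrow> l" and nonneg: "\<forall>\<^sub>F n in sequentially. 0 \<le> x n"
  shows "(\<lambda>n. (1 - x n) ^ n) \<longlonglongrightarrow> exp (- l)"
proof -
  have x0: "x \<longlonglongrightarrow> 0"
  proof (rule Lim_transform_eventually)
    show "(\<lambda>n. (real n * x n) * inverse (real n)) \<longlonglongrightarrow> 0"
      using tendsto_mult[OF lim lim_inverse_n] by simp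
    show "\<forall>\<^sub>F n in sequentially. real n * x n * inverse (real n) = x n"
      using eventually_gt_at_top[of 0] by eventually_elim simp
  qed
  have small: "\<forall>\<^sub>F n in sequentially. x n < 1 / 2"
    by (rule order_tendstoD[OF x0]) simp
  have "(\<lambda>n. real n * ln (1 - x n)) \<longlonglongrightarrow> - l"
  proof (rule tendsto_sandwich)
    show "\<forall>\<^sub>F n in sequentially. - (real n * x n) - 2 * (real n * x n) * x n \<le> real n * ln (1 - x n)"
      using nonneg small
    proof eventually_elim
      case (elim n)
      then have "real n * (- x n - 2 * (x n)\<^sup>2) \<le> real n * ln (1 - x n)"
        by (intro mult_left_mono ln_one_minus_pos_lower_bound) auto
      then show ?case by (simp add: algebra_simps power2_eq_square)
    qed
    show "\<forall>\<^sub>F n in sequentially. real n * ln (1 - x n) \<le> - (real n * x n)"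
      using small
    proof eventually_elim
      case (elim n)
      then have "real n * ln (1 - x n) \<le> real n * (- x n)"
        using ln_add_one_self_le_self2[of "- x n"] by (intro mult_left_mono) auto
      then show ?case by simp
    qed
    show "(\<lambda>n. - (real n * x n) - 2 * (real n * x n) * x n) \<longlonglongrightarrow> - l"
      using tendsto_diff[OF tendsto_minus[OF lim] tendsto_mult[OF tendsto_mult[OF tendsto_const[of 2] lim] x0]] by simp
    show "(\<lambda>n. - (real n * x n)) \<longlonglongrightarrow> - l"
      by (rule tendsto_minus[OF lim])
  qed
  then have "(\<lambda>n. exp (real n * ln (1 - x n))) \<longlonglongrightarrow> exp (- l)"
    by (rule tendsto_exp)
  then show ?thesis
  proof (rule Lim_transform_eventually)
    show "\<forall>\<^sub>F n in sequentially. exp (real n * ln (1 - x n)) = (1 - x n) ^ n"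
      using small by eventually_elim (simp add: exp_of_nat_mult)
  qed
qed

definition crit_scale :: "nat \<Rightarrow> nat \<Rightarrow> real" where
  "crit_scale k n = real n powr (- 1 - 1 / real k)"

lemma crit_scale_nonneg [simp]: "0 \<le> crit_scale k n"
  by (simp add: crit_scale_def)

text \<open>
  Up to a constant, the expected number of patterns of \<open>i\<close> open vertices with \<open>j\<close> degrees of freedom
  has this form, so its order of growth is read off from the exponent of \<open>n\<close>.
\<close>

lemma power_times_scale:
  assumes "0 < n"
  shows "real n ^ j * (a * crit_scale k n) ^ i = a ^ i * real n powr (real j - real i - real i / real k)"
proof -
  have "real n ^ j * (a * crit_scale k n) ^ i = a ^ i * (real n powr real j * real n powr (real i * (- 1 - 1 / real k)))"
    using assms by (simp add: crit_scale_def power_mult_distrib powr_power powr_realpow)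
  also have "real n powr real j * real n powr (real i * (- 1 - 1 / real k))
      = real n powr (real j - real i - real i / real k)"
    by (simp add: powr_add[symmetric] algebra_simps)
  finally show ?thesis .
qed

lemma scale_limit: "(\<lambda>n. a * crit_scale k n) \<longlonglongrightarrow> 0"
proof -
  have "0 < 1 + 1 / real k" by (intro add_pos_nonneg) auto
  then have "crit_scale k \<longlonglongrightarrow> 0"
    unfolding crit_scale_def using powr_neg_limit[of "1 + 1 / real k"] by simp
  then show ?thesis using tendsto_mult_right_zero by blast
qed

lemma n_times_scale_limit:
  assumes "0 < k"
  shows "(\<lambda>n. real n * (a * crit_scale k n)) \<longlonglongrightarrow> 0"
proof (rule Lim_transform_eventually)
  show "(\<lambda>n. a * real n powr (- (1 / real k))) \<longlonglongrightarrow> 0"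
    using assms by (intro tendsto_mult_right_zero powr_neg_limit) simp
  show "\<forall>\<^sub>F n in sequentially. a * real n powr (- (1 / real k)) = real n * (a * crit_scale k n)"
    using eventually_gt_at_top[of 0]
  proof eventually_elim
    case (elim n)
    show ?case using power_times_scale[OF elim, of 1 a k 1, symmetric] by simp
  qed
qed

lemma power_times_scale_limit:
  assumes "real j - real i - real i / real k < 0"
  shows "(\<lambda>n. real n ^ j * (a * crit_scale k n) ^ i) \<longlonglongrightarrow> 0"
proof (rule Lim_transform_eventually)
  show "(\<lambda>n. a ^ i * real n powr (- (real i + real i / real k - real j))) \<longlonglongrightarrow> 0"
    using assms by (intro tendsto_mult_right_zero powr_neg_limit) simp
  show "\<forall>\<^sub>F n in sequentially. a ^ i * real n powr (- (real i + real i / real k - real j))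
      = real n ^ j * (a * crit_scale k n) ^ i"
    using eventually_gt_at_top[of 0] by eventually_elim (simp add: power_times_scale diff_diff_eq)
qed

lemma scale_prob:
  assumes "0 < a"
  shows "\<forall>\<^sub>F n in sequentially. 0 \<le> a * crit_scale k n \<and> a * crit_scale k n \<le> 1 / 2"
proof -
  have "\<forall>\<^sub>F n in sequentially. a * crit_scale k n < 1 / 2"
    by (rule order_tendstoD[OF scale_limit]) simp
  then show ?thesis
    by eventually_elim (use assms in simp)
qed

lemma binomial_times_scale:
  assumes "0 < n"
  shows "real (n choose m) * (a * crit_scale k n) ^ m
    = real (n choose m) / real n ^ m * a ^ m * real n powr (- (real m / real k))"
proof -
  have "real (n choose m) * (a * crit_scale k n) ^ m
      = real (n choose m) / real n ^ m * (real n ^ m * (a * crit_scale k n) ^ m)"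
    using assms by simp
  also have "real n ^ m * (a * crit_scale k n) ^ m = a ^ m * real n powr (- (real m / real k))"
    using power_times_scale[OF assms, of m a k m] by simp
  finally show ?thesis by simp
qed

lemma dense_prob_ub_limit:
  "(\<lambda>n. real n powr (real m / real k) * (real (n choose m) * (a * crit_scale k n) ^ m)) \<longlonglongrightarrow> a ^ m / fact m"
proof (rule Lim_transform_eventually)
  show "(\<lambda>n. real (n choose m) / real n ^ m * a ^ m) \<longlonglongrightarrow> a ^ m / fact m"
    using tendsto_mult[OF binomial_over_power_limit[of m] tendsto_const[of "a ^ m"]] by simp
  show "\<forall>\<^sub>F n in sequentially. real (n choose m) / real n ^ m * a ^ m
      = real n powr (real m / real k) * (real (n choose m) * (a * crit_scale k n) ^ m)"
    using eventually_gt_at_top[of 0]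
  proof eventually_elim
    case (elim n)
    then have "real n powr (- (real m / real k)) * real n powr (real m / real k) = 1"
      by (simp add: powr_add[symmetric])
    then show ?case
      unfolding binomial_times_scale[OF elim] by (simp add: algebra_simps)
  qed
qed

lemma one_minus_scale_power_limit:
  assumes "0 < a" "0 < k"
  shows "(\<lambda>n. (1 - a * crit_scale k n) ^ (n - m)) \<longlonglongrightarrow> 1"
proof (rule tendsto_sandwich)
  show "\<forall>\<^sub>F n in sequentially. 1 - real n * (a * crit_scale k n) \<le> (1 - a * crit_scale k n) ^ (n - m)"
    using scale_prob[OF assms(1), of k]
  proof eventually_elim
    case (elim n)
    then have "1 - real n * (a * crit_scale k n) \<le> (1 - a * crit_scale k n) ^ n"
      using Bernoulli_inequality[of "- (a * crit_scale k n)" n] by simp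
    also have "\<dots> \<le> (1 - a * crit_scale k n) ^ (n - m)"
      using elim by (intro power_decreasing) auto
    finally show ?case .
  qed
  show "\<forall>\<^sub>F n in sequentially. (1 - a * crit_scale k n) ^ (n - m) \<le> 1"
    using scale_prob[OF assms(1), of k] by eventually_elim (auto intro: power_le_one)
  show "(\<lambda>n. 1 - real n * (a * crit_scale k n)) \<longlonglongrightarrow> 1"
    using tendsto_diff[OF tendsto_const[of 1] n_times_scale_limit[OF assms(2), of a]] by simp
qed simp

lemma dense_prob_lb_limit:
  assumes "0 < a" "0 < k"
  shows "(\<lambda>n. real n powr (real m / real k) * dense_prob_lb n (a * crit_scale k n) m) \<longlonglongrightarrow> a ^ m / fact m"
  using tendsto_mult[OF dense_prob_ub_limit[of m k a] one_minus_scale_power_limit[OF assms, of m]]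
  by (simp add: dense_prob_lb_def mult.assoc)

text \<open>
  A line is dense with probability asymptotic to \<open>a\<^sup>k / (k! n)\<close>, and the \<open>n\<close> parallel lines are
  independent.
\<close>

lemma has_line_limit:
  assumes "0 < a" "0 < k" "b < 2"
  shows "(\<lambda>n. bprob (torus n 2) (a * crit_scale k n) (has_line n k b)) \<longlonglongrightarrow> 1 - exp (- (a ^ k / fact k))"
proof (rule tendsto_sandwich)
  let ?p = "\<lambda>n. a * crit_scale k n"
  let ?u = "\<lambda>n. real (n choose k) * ?p n ^ k"
  have npow: "\<forall>\<^sub>F n in sequentially. real n powr (real k / real k) = real n"
    using assms by simp
  have u: "(\<lambda>n. real n * ?u n) \<longlonglongrightarrow> a ^ k / fact k"
    using dense_prob_ub_limit[of k k a] assms by simp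
  have l: "(\<lambda>n. real n * dense_prob_lb n (?p n) k) \<longlonglongrightarrow> a ^ k / fact k"
    using dense_prob_lb_limit[of a k k] assms by simp
  have "\<forall>\<^sub>F n in sequentially. 0 \<le> dense_prob_lb n (?p n) k"
    using scale_prob[OF assms(1), of k] by eventually_elim (simp add: dense_prob_lb_def)
  then have "(\<lambda>n. (1 - dense_prob_lb n (?p n) k) ^ n) \<longlonglongrightarrow> exp (- (a ^ k / fact k))"
    by (rule one_minus_power_limit[OF l])
  then show "(\<lambda>n. 1 - (1 - dense_prob_lb n (?p n) k) ^ n) \<longlonglongrightarrow> 1 - exp (- (a ^ k / fact k))"
    by (intro tendsto_diff tendsto_const)
  have "(\<lambda>n. (1 - ?u n) ^ n) \<longlonglongrightarrow> exp (- (a ^ k / fact k))"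
    by (rule one_minus_power_limit[OF u]) (use assms in simp)
  then show "(\<lambda>n. 1 - (1 - ?u n) ^ n) \<longlonglongrightarrow> 1 - exp (- (a ^ k / fact k))"
    by (intro tendsto_diff tendsto_const)
  show "\<forall>\<^sub>F n in sequentially. 1 - (1 - dense_prob_lb n (?p n) k) ^ n \<le> bprob (torus n 2) (?p n) (has_line n k b)"
    using scale_prob[OF assms(1), of k]
  proof eventually_elim
    case (elim n)
    then show ?case by (intro has_line_prob(1) assms(3)) auto
  qed
  have "?u \<longlonglongrightarrow> 0"
  proof (rule Lim_transform_eventually)
    show "(\<lambda>n. real n * ?u n * inverse (real n)) \<longlonglongrightarrow> 0"
      using tendsto_mult[OF u lim_inverse_n] by simp
    show "\<forall>\<^sub>F n in sequentially. real n * ?u n * inverse (real n) = ?u n"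
      using eventually_gt_at_top[of 0] by eventually_elim simp
  qed
  then have "\<forall>\<^sub>F n in sequentially. ?u n < 1"
    by (rule order_tendstoD) simp
  then show "\<forall>\<^sub>F n in sequentially. bprob (torus n 2) (?p n) (has_line n k b) \<le> 1 - (1 - ?u n) ^ n"
    using scale_prob[OF assms(1), of k]
  proof eventually_elim
    case (elim n)
    then show ?case by (intro has_line_prob(2) assms(3)) auto
  qed
qed

text \<open>
  A line has \<open>k - 1\<close> open vertices with probability of order \<open>n\<close> to the power \<open>1 / k - 1\<close>, so that
  the expected number of such lines is of order \<open>n\<close> to the power \<open>1 / k\<close>; having fewer than \<open>M\<close> of them
  is exponentially unlikely in this number, which beats the polynomial factor.
\<close>

lemma few_lines_limit:
  assumes "0 < a" "1 < k"
  shows "(\<lambda>n. real n ^ M * (1 - dense_prob_lb n (a * crit_scale k n) (k - 1)) ^ (n - M)) \<longlonglongrightarrow> 0"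
proof (rule tendsto_sandwich[OF _ _ tendsto_const])
  define l where "l n = dense_prob_lb n (a * crit_scale k n) (k - 1)" for n
  define c where "c = a ^ (k - 1) / fact (k - 1)"
  define e where "e = 1 / real k"
  have c: "c > 0" and e: "e > 0" and ek: "real (k - 1) / real k = 1 - e"
    using assms by (auto simp: c_def e_def of_nat_diff diff_divide_distrib)
  have "(\<lambda>n. real n powr (1 - e) * l n) \<longlonglongrightarrow> c"
    using dense_prob_lb_limit[of a k "k - 1"] assms unfolding ek l_def c_def by simp
  then have big: "\<forall>\<^sub>F n in sequentially. c / 2 < real n powr (1 - e) * l n"
    by (rule order_tendstoD) (use c in simp)
  have l01: "\<forall>\<^sub>F n in sequentially. l n \<le> 1"
    using scale_prob[OF assms(1), of k]
  proof eventually_elim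
    case (elim n)
    have "pmf (binomial_pmf n (a * crit_scale k n)) (k - 1) \<le> 1" by (rule pmf_le_1)
    then show ?case using elim by (simp add: l_def dense_prob_lb_def)
  qed
  show "\<forall>\<^sub>F n in sequentially. 0 \<le> real n ^ M * (1 - l n) ^ (n - M)"
    using l01 by eventually_elim simp
  \<comment> \<open>One half of \<open>c\<close> is given up for \<open>l\<close> not having reached its limit, another for \<open>n - M \<ge> n / 2\<close>.\<close>
  show "\<forall>\<^sub>F n in sequentially. real n ^ M * (1 - l n) ^ (n - M) \<le> real n powr real M * exp (- (c / 4 * real n powr e))"
    using l01 big eventually_ge_at_top[of "2 * M + 1"]
  proof eventually_elim
    case (elim n)
    have split: "real n = real n powr (1 - e) * real n powr e"
      using elim by (simp add: powr_add[symmetric])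
    have nM: "real n / 2 \<le> real (n - M)" using elim by simp
    have "0 < real n powr (1 - e) * l n" using elim(2) c by linarith
    then have l0: "0 \<le> l n" by (simp add: zero_less_mult_iff)
    have "c / 4 * real n powr e = (c / 2) * real n powr e / 2" by simp
    also have "\<dots> \<le> (real n powr (1 - e) * l n) * real n powr e / 2"
      using elim(2) by (intro divide_right_mono mult_right_mono) auto
    also have "\<dots> = l n * (real n / 2)"
      by (subst split) (simp add: algebra_simps)
    also have "\<dots> \<le> l n * real (n - M)"
      using nM l0 by (rule mult_left_mono)
    finally have expo: "c / 4 * real n powr e \<le> l n * real (n - M)" .
    have "(1 - l n) ^ (n - M) \<le> exp (- l n) ^ (n - M)"
      using elim exp_ge_add_one_self[of "- l n"] by (intro power_mono) auto
    also have "\<dots> = exp (- (l n * real (n - M)))"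
      by (simp add: exp_of_nat_mult[symmetric] mult.commute)
    also have "\<dots> \<le> exp (- (c / 4 * real n powr e))"
      using expo by simp
    finally show ?case
      using elim(3) by (simp add: powr_realpow mult_left_mono)
  qed
  show "(\<lambda>n. real n powr real M * exp (- (c / 4 * real n powr e))) \<longlonglongrightarrow> 0"
    using c e by real_asymp
qed

lemma not_typical_limit:
  assumes "0 < a" "1 < k"
  shows "(\<lambda>n. bprob (torus n 2) (a * crit_scale k n) (\<lambda>\<omega>. \<not> typical n k M \<omega>)) \<longlonglongrightarrow> 0"
proof (rule tendsto_sandwich[OF _ _ tendsto_const])
  let ?p = "\<lambda>n. a * crit_scale k n"
  let ?ub = "\<lambda>n. 2 * (real n ^ (k + 2) * ?p n ^ (k + 1))
    + 2 * (real n ^ M * (1 - dense_prob_lb n (?p n) (k - 1)) ^ (n - M))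
    + real n ^ (2 * k) * ?p n ^ (2 * k - 1)"
  show "\<forall>\<^sub>F n in sequentially. 0 \<le> bprob (torus n 2) (?p n) (\<lambda>\<omega>. \<not> typical n k M \<omega>)" by simp
  show "\<forall>\<^sub>F n in sequentially. bprob (torus n 2) (?p n) (\<lambda>\<omega>. \<not> typical n k M \<omega>) \<le> ?ub n"
    using scale_prob[OF assms(1), of k] eventually_ge_at_top[of M]
    by eventually_elim (rule not_typical_prob, use assms in auto)
  have "(\<lambda>n. real n ^ (k + 2) * ?p n ^ (k + 1)) \<longlonglongrightarrow> 0"
    using assms by (intro power_times_scale_limit) (auto simp: field_simps)
  moreover have "(\<lambda>n. real n ^ (2 * k) * ?p n ^ (2 * k - 1)) \<longlonglongrightarrow> 0"
    using assms by (intro power_times_scale_limit) (auto simp: field_simps of_nat_diff)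
  ultimately have "?ub \<longlonglongrightarrow> 2 * 0 + 2 * 0 + 0"
    by (intro tendsto_add tendsto_mult tendsto_const few_lines_limit[OF assms])
  then show "?ub \<longlonglongrightarrow> 0" by simp
qed

definition seed_limit :: "nat \<Rightarrow> nat \<Rightarrow> real \<Rightarrow> real" where
  "seed_limit \<theta> k a = (if odd \<theta> then 1 - exp (- 2 * a ^ k / fact k)
                  else (1 - exp (- (a ^ k) / fact k)) ^ 2)"

text \<open>
  The two directions become independent, and \<open>1 - (1 - x)\<^sup>2\<close> with \<open>x = 1 - exp (- a\<^sup>k / k!)\<close> is
  the probability that at least one of them has a dense line.
\<close>

lemma seed_prob_limit:
  assumes "0 < a" "1 < k"
  shows "(\<lambda>n. bprob (torus n 2) (a * crit_scale k n) (seed n \<theta> k)) \<longlonglongrightarrow> seed_limit \<theta> k a"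
proof -
  let ?P = "\<lambda>n. bprob (torus n 2) (a * crit_scale k n)"
  let ?l = "1 - exp (- (a ^ k / fact k))"
  have lim: "(\<lambda>n. ?P n (has_line n k b)) \<longlonglongrightarrow> ?l" if "b < 2" for b
    using has_line_limit[OF assms(1) _ that, of k] assms by simp
  have lim2: "(\<lambda>n. ?P n (has_line n k 0) * ?P n (has_line n k 1)) \<longlonglongrightarrow> ?l * ?l"
    by (intro tendsto_mult lim) auto
  have both: "(\<lambda>n. ?P n (\<lambda>\<omega>. has_line n k 0 \<omega> \<and> has_line n k 1 \<omega>)) \<longlonglongrightarrow> ?l * ?l"
  proof (rule tendsto_sandwich[OF _ _ lim2])
    show "\<forall>\<^sub>F n in sequentially. ?P n (has_line n k 0) * ?P n (has_line n k 1)
        \<le> ?P n (\<lambda>\<omega>. has_line n k 0 \<omega> \<and> has_line n k 1 \<omega>)"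
      using scale_prob[OF assms(1), of k] by eventually_elim (rule both_has_line_prob(1), auto)
    let ?err = "\<lambda>n. real n ^ (2 * k) * (a * crit_scale k n) ^ (2 * k - 1)"
    show "\<forall>\<^sub>F n in sequentially. ?P n (\<lambda>\<omega>. has_line n k 0 \<omega> \<and> has_line n k 1 \<omega>)
        \<le> ?P n (has_line n k 0) * ?P n (has_line n k 1) + ?err n"
      using scale_prob[OF assms(1), of k]
    proof eventually_elim
      case (elim n)
      then show ?case
        using both_has_line_prob(2)[of "a * crit_scale k n" n k]
          double_vertex_prob[of "a * crit_scale k n" k n] assms by simp
    qed
    have "?err \<longlonglongrightarrow> 0"
      using assms by (intro power_times_scale_limit) (auto simp: field_simps of_nat_diff)
    then show "(\<lambda>n. ?P n (has_line n k 0) * ?P n (has_line n k 1) + ?err n) \<longlonglongrightarrow> ?l * ?l"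
      using tendsto_add[OF lim2] by fastforce
  qed
  show ?thesis
  proof (cases "odd \<theta>")
    case True
    have "(\<lambda>n. ?P n (has_line n k 0) + ?P n (has_line n k 1)
        - ?P n (\<lambda>\<omega>. has_line n k 0 \<omega> \<and> has_line n k 1 \<omega>)) \<longlonglongrightarrow> ?l + ?l - ?l * ?l"
      by (intro tendsto_diff tendsto_add lim both) auto
    moreover have "?l + ?l - ?l * ?l = seed_limit \<theta> k a"
      using True exp_double[of "- (a ^ k / fact k)"]
      by (simp add: seed_limit_def algebra_simps power2_eq_square)
    moreover have "seed n \<theta> k = (\<lambda>\<omega>. has_line n k 0 \<omega> \<or> has_line n k 1 \<omega>)" for n
      using True by (simp add: seed_def fun_eq_iff)
    ultimately show ?thesis by (simp add: bprob_disj)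
  next
    case False
    then have "seed n \<theta> k = (\<lambda>\<omega>. has_line n k 0 \<omega> \<and> has_line n k 1 \<omega>)" for n
      by (simp add: seed_def fun_eq_iff)
    moreover have "?l * ?l = seed_limit \<theta> k a"
      using False by (simp add: seed_limit_def power2_eq_square)
    ultimately show ?thesis using both by simp
  qed
qed

lemma seed_equivalent_limit:
  assumes "0 < a" "1 < k"
    and eq: "\<And>n \<omega>. k < n \<Longrightarrow> typical n k M \<omega> \<Longrightarrow> E n \<omega> \<longleftrightarrow> seed n \<theta> k \<omega>"
  shows "(\<lambda>n. bprob (torus n 2) (a * crit_scale k n) (E n)) \<longlonglongrightarrow> seed_limit \<theta> k a"
proof -
  let ?P = "\<lambda>n. bprob (torus n 2) (a * crit_scale k n)"
  let ?T = "\<lambda>n \<omega>. \<not> typical n k M \<omega>"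
  have le: "?P n F \<le> ?P n G + ?P n (?T n)" if "\<And>\<omega>. typical n k M \<omega> \<Longrightarrow> F \<omega> \<Longrightarrow> G \<omega>" for n F G
  proof -
    have "?P n F \<le> ?P n (\<lambda>\<omega>. G \<omega> \<or> ?T n \<omega>)"
      by (rule bprob_mono) (use that in blast)
    also have "\<dots> \<le> ?P n G + ?P n (?T n)" by (rule bprob_disj_le)
    finally show ?thesis .
  qed
  show ?thesis
  proof (rule tendsto_sandwich)
    show "\<forall>\<^sub>F n in sequentially. ?P n (seed n \<theta> k) - ?P n (?T n) \<le> ?P n (E n)"
      using eventually_gt_at_top[of k]
    proof eventually_elim
      case (elim n)
      show ?case using le[of n "seed n \<theta> k" "E n"] eq[OF elim] by simp
    qed
    show "\<forall>\<^sub>F n in sequentially. ?P n (E n) \<le> ?P n (seed n \<theta> k) + ?P n (?T n)"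
      using eventually_gt_at_top[of k]
    proof eventually_elim
      case (elim n)
      show ?case using le[of n "E n" "seed n \<theta> k"] eq[OF elim] by simp
    qed
    show "(\<lambda>n. ?P n (seed n \<theta> k) - ?P n (?T n)) \<longlonglongrightarrow> seed_limit \<theta> k a"
      using tendsto_diff[OF seed_prob_limit[OF assms(1,2)] not_typical_limit[OF assms(1,2)]] by simp
    show "(\<lambda>n. ?P n (seed n \<theta> k) + ?P n (?T n)) \<longlonglongrightarrow> seed_limit \<theta> k a"
      using tendsto_add[OF seed_prob_limit[OF assms(1,2)] not_typical_limit[OF assms(1,2)]] by simp
  qed
qed

section \<open>Critical values\<close>

lemma prob_initial_config: "measure_pmf.prob (initial_config n 2 p) {\<omega>. E \<omega>} = bprob (torus n 2) p E"
  by (simp add: initial_config_def bprob_def)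

lemma seed_limit_strict_mono:
  assumes "0 \<le> a" "a < b" "0 < k"
  shows "seed_limit \<theta> k a < seed_limit \<theta> k b"
proof -
  define x where "x = a ^ k / (fact k :: real)"
  define y where "y = b ^ k / (fact k :: real)"
  have "a ^ k < b ^ k" using assms by (intro power_strict_mono) auto
  then have xy: "x < y" "0 \<le> x"
    using assms by (auto simp: x_def y_def divide_strict_right_mono)
  have "seed_limit \<theta> k c = (if odd \<theta> then 1 - exp (- 2 * (c ^ k / fact k)) else (1 - exp (- (c ^ k / fact k))) ^ 2)" for c
    by (simp add: seed_limit_def)
  then show ?thesis
    using xy by (auto simp: x_def[symmetric] y_def[symmetric] intro!: power_strict_mono)
qed

text \<open>
  The solution \<open>a\<close> of \<open>seed_limit \<theta> k a = 1 / 2\<close>, found by solving for \<open>a\<^sup>k / k!\<close> first.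
\<close>

definition crit_const :: "nat \<Rightarrow> nat \<Rightarrow> real" where
  "crit_const \<theta> k = root k (fact k * (if odd \<theta> then ln 2 / 2 else - ln (1 - sqrt (1 / 2))))"

lemma sqrt_half: "0 < sqrt (1 / 2)" "sqrt (1 / 2) < 1"
  by (simp_all add: real_sqrt_divide)

lemma crit_const_pos: "0 < k \<Longrightarrow> 0 < crit_const \<theta> k"
  using sqrt_half by (auto simp: crit_const_def ln_less_zero)

lemma seed_limit_crit_const:
  assumes "0 < k"
  shows "seed_limit \<theta> k (crit_const \<theta> k) = 1 / 2"
proof -
  define x where "x = (if odd \<theta> then ln 2 / 2 else - ln (1 - sqrt (1 / 2)))"
  have "0 \<le> x" using sqrt_half by (auto simp: x_def intro!: less_imp_le ln_less_zero)
  then have pow: "crit_const \<theta> k ^ k = fact k * x"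
    using assms unfolding crit_const_def x_def[symmetric] by simp
  show ?thesis
  proof (cases "odd \<theta>")
    case True
    then show ?thesis
      by (simp add: seed_limit_def pow) (simp add: x_def exp_minus)
  next
    case False
    have "exp (- x) = 1 - sqrt (1 / 2)"
      using False sqrt_half by (simp add: x_def)
    moreover have "(sqrt (1 / 2))\<^sup>2 = 1 / 2" by (rule real_sqrt_pow2) simp
    ultimately show ?thesis
      using False by (simp add: seed_limit_def pow)
  qed
qed

text \<open>
  For \<open>a\<close> below the solution of \<open>seed_limit \<theta> k a = 1 / 2\<close> the probability at density \<open>a n\<close> to the power
  \<open>- 1 - 1 / k\<close> eventually lies below one half, and above the solution it eventually exceeds one half;
  by monotonicity the critical value is trapped between the two densities.
\<close>

lemma critical_value_limit:
  assumes k: "1 < k"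
    and inc: "\<And>n. increasing (E n)"
    and nontrivial: "\<forall>\<^sub>F n in sequentially. \<not> E n (\<lambda>_. False) \<and> E n (\<lambda>v. v \<in> torus n 2)"
    and lim: "\<And>a. 0 < a \<Longrightarrow>
      (\<lambda>n. bprob (torus n 2) (a * crit_scale k n) (E n)) \<longlonglongrightarrow> seed_limit \<theta> k a"
    and pc: "\<And>n. 1 \<le> n \<Longrightarrow> pc n = (THE p. 0 \<le> p \<and> p \<le> 1 \<and> bprob (torus n 2) p (E n) = 1 / 2)"
  shows "(\<lambda>n. pc n / crit_scale k n) \<longlonglongrightarrow> crit_const \<theta> k"
proof -
  have k0: "0 < k" using k by simp
  have half: "\<forall>\<^sub>F n in sequentially. 0 \<le> pc n \<and> pc n \<le> 1 \<and> bprob (torus n 2) (pc n) (E n) = 1 / 2"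
    using nontrivial eventually_ge_at_top[of 1]
  proof eventually_elim
    case (elim n)
    then have "\<exists>!p. 0 \<le> p \<and> p \<le> 1 \<and> bprob (torus n 2) p (E n) = 1 / 2"
      by (intro bprob_half_unique inc) auto
    from theI'[OF this] show ?case unfolding pc[OF elim(2)] .
  qed
  have pos: "\<forall>\<^sub>F n in sequentially. 0 < crit_scale k n"
    using eventually_gt_at_top[of 0] by eventually_elim (simp add: crit_scale_def)
  show ?thesis
  proof (rule order_tendstoI)
    fix y assume y: "y < crit_const \<theta> k"
    obtain a where a: "max y 0 < a" "a < crit_const \<theta> k"
      using dense[of "max y 0" "crit_const \<theta> k"] y crit_const_pos[OF k0] by auto
    then have "seed_limit \<theta> k a < 1 / 2"
      using seed_limit_strict_mono[of a "crit_const \<theta> k" k \<theta>] seed_limit_crit_const[OF k0, of \<theta>] k0 by simp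
    then have "\<forall>\<^sub>F n in sequentially. bprob (torus n 2) (a * crit_scale k n) (E n) < 1 / 2"
      using a lim[of a] by (intro order_tendstoD(2)) auto
    moreover have "\<forall>\<^sub>F n in sequentially. 0 \<le> a * crit_scale k n \<and> a * crit_scale k n \<le> 1 / 2"
      using a by (intro scale_prob) simp
    ultimately show "\<forall>\<^sub>F n in sequentially. y < pc n / crit_scale k n"
      using half pos
    proof eventually_elim
      case (elim n)
      have "a * crit_scale k n < pc n"
      proof (rule ccontr)
        assume "\<not> a * crit_scale k n < pc n"
        then have "bprob (torus n 2) (pc n) (E n) \<le> bprob (torus n 2) (a * crit_scale k n) (E n)"
          using elim by (intro bprob_weak_mono inc) auto
        with elim show False by simp
      qed
      moreover have "y * crit_scale k n < a * crit_scale k n"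
        using a elim by (intro mult_strict_right_mono) auto
      ultimately have "y * crit_scale k n < pc n" by (rule less_trans[rotated])
      then show ?case using elim by (simp add: pos_less_divide_eq)
    qed
  next
    fix y assume y: "crit_const \<theta> k < y"
    obtain a where a: "crit_const \<theta> k < a" "a < y" using dense[OF y] by blast
    have a0: "0 < a" using a(1) crit_const_pos[OF k0, of \<theta>] by simp
    have "1 / 2 < seed_limit \<theta> k a"
      using seed_limit_strict_mono[of "crit_const \<theta> k" a k \<theta>] seed_limit_crit_const[OF k0, of \<theta>]
        crit_const_pos[OF k0, of \<theta>] k0 a by simp
    then have "\<forall>\<^sub>F n in sequentially. 1 / 2 < bprob (torus n 2) (a * crit_scale k n) (E n)"
      using lim[OF a0] by (intro order_tendstoD(1)) auto
    moreover have "\<forall>\<^sub>F n in sequentially. 0 \<le> a * crit_scale k n \<and> a * crit_scale k n \<le> 1 / 2"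
      by (rule scale_prob[OF a0])
    ultimately show "\<forall>\<^sub>F n in sequentially. pc n / crit_scale k n < y"
      using half pos
    proof eventually_elim
      case (elim n)
      have "pc n < a * crit_scale k n"
      proof (rule ccontr)
        assume "\<not> pc n < a * crit_scale k n"
        then have "bprob (torus n 2) (a * crit_scale k n) (E n) \<le> bprob (torus n 2) (pc n) (E n)"
          using elim by (intro bprob_weak_mono inc) auto
        with elim show False by simp
      qed
      moreover have "a * crit_scale k n < y * crit_scale k n"
        using a elim by (intro mult_strict_right_mono) auto
      ultimately have "pc n < y * crit_scale k n" by (rule less_trans)
      then show ?case using elim by (simp add: pos_divide_less_eq)
    qed
  qed
qed

lemma half_threshold:
  assumes "k = nat \<lceil>real \<theta> / 2\<rceil>"
  shows "\<theta> = 2 * k \<or> (\<theta> = 2 * k - 1 \<and> odd \<theta>)"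
proof (cases "even \<theta>")
  case True
  then obtain m where "\<theta> = 2 * m" by (elim evenE)
  then show ?thesis using assms by simp
next
  case False
  then obtain m where m: "\<theta> = 2 * m + 1" by (elim oddE)
  then have "\<lceil>real \<theta> / 2\<rceil> = int m + 1" by (intro ceiling_unique) auto
  then show ?thesis using assms m by (simp add: nat_add_distrib)
qed

lemma bootstrap_limit_empty: "0 < \<theta> \<Longrightarrow> bootstrap_limit n d \<theta> (\<lambda>_. False) = (\<lambda>_. False)"
  by (rule bootstrap_limit_stuck) (simp add: open_nbrs_def)

lemma critical_values_limit:
  assumes k: "k = nat \<lceil>real \<theta> / 2\<rceil>" "1 < k"
  shows "(\<lambda>n. p_crit 2 2 \<theta> n / crit_scale k n) \<longlonglongrightarrow> crit_const \<theta> k"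
    and "(\<lambda>n. p_crit 1 2 \<theta> n / crit_scale k n) \<longlonglongrightarrow> crit_const \<theta> k"
    and "(\<lambda>n. p_crit_star0 2 \<theta> n / crit_scale k n) \<longlonglongrightarrow> crit_const \<theta> k"
proof -
  note \<theta> = half_threshold[OF k(1)]
  have \<theta>0: "0 < \<theta>" using \<theta> k(2) by auto
  let ?full = "\<lambda>n \<omega>. \<forall>v\<in>torus n 2. bootstrap_limit n 2 \<theta> \<omega> v"
  let ?line = "\<lambda>n \<omega>. \<exists>b<2. \<exists>i\<in>{1..n}. \<forall>v\<in>line n b i. bootstrap_limit n 2 \<theta> \<omega> v"
  let ?dense = "\<lambda>n \<omega>. \<exists>v\<in>torus n 2. \<theta> \<le> open_nbrs n 2 \<omega> v"
  have some_vertex: "crossing 0 1 1 \<in> torus n 2" if "1 \<le> n" for n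
    using that by (intro crossing_in_torus) auto
  show "(\<lambda>n. p_crit 2 2 \<theta> n / crit_scale k n) \<longlonglongrightarrow> crit_const \<theta> k"
  proof (rule critical_value_limit[OF k(2), where E = ?full])
    show "increasing (?full n)" for n
      by (intro increasingI ballI) (metis bootstrap_limit_mono)
    show "\<forall>\<^sub>F n in sequentially. \<not> ?full n (\<lambda>_. False) \<and> ?full n (\<lambda>v. v \<in> torus n 2)"
      using eventually_ge_at_top[of 1]
      by eventually_elim (use some_vertex in \<open>auto simp: bootstrap_limit_empty \<theta>0 bootstrap_limit_ge\<close>)
    show "(\<lambda>n. bprob (torus n 2) (a * crit_scale k n) (?full n)) \<longlonglongrightarrow> seed_limit \<theta> k a" if "0 < a" for a
      using that k(2) by (rule seed_equivalent_limit) (rule seed_iff(1)[OF _ \<theta>])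
    show "p_crit 2 2 \<theta> n = (THE p. 0 \<le> p \<and> p \<le> 1 \<and> bprob (torus n 2) p (?full n) = 1 / 2)" if "1 \<le> n" for n
      unfolding p_crit_def prob_initial_config subgraphs_2_2[OF that] by simp
  qed
  show "(\<lambda>n. p_crit 1 2 \<theta> n / crit_scale k n) \<longlonglongrightarrow> crit_const \<theta> k"
  proof (rule critical_value_limit[OF k(2), where E = ?line])
    show "increasing (?line n)" for n
    proof (rule increasingI)
      fix \<omega> \<omega>' :: "vertex \<Rightarrow> bool"
      assume "?line n \<omega>" and le: "\<And>v. \<omega> v \<Longrightarrow> \<omega>' v"
      then obtain b i where "b < 2" "i \<in> {1..n}" "\<forall>v\<in>line n b i. bootstrap_limit n 2 \<theta> \<omega> v" by blast
      then show "?line n \<omega>'"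
        using bootstrap_limit_mono[of \<omega> \<omega>', OF le]
        by (intro exI[of _ b] conjI bexI[of _ i]) auto
    qed
    show "\<forall>\<^sub>F n in sequentially. \<not> ?line n (\<lambda>_. False) \<and> ?line n (\<lambda>v. v \<in> torus n 2)"
      using eventually_ge_at_top[of 1]
    proof eventually_elim
      case (elim n)
      have "line n b i \<noteq> {}" if "b < 2" "i \<in> {1..n}" for b i
        using crossing_in_lines(1)[OF that that(2)] by auto
      moreover have "\<forall>v\<in>line n 0 1. bootstrap_limit n 2 \<theta> (\<lambda>v. v \<in> torus n 2) v"
        by (intro ballI bootstrap_limit_ge) (rule subsetD[OF line_subset])
      ultimately show ?case
        unfolding bootstrap_limit_empty[OF \<theta>0] using elim
        by (intro conjI exI[of _ 0] bexI[of _ 1]) auto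
    qed
    show "(\<lambda>n. bprob (torus n 2) (a * crit_scale k n) (?line n)) \<longlonglongrightarrow> seed_limit \<theta> k a" if "0 < a" for a
      using that k(2) by (rule seed_equivalent_limit) (rule seed_iff(2)[OF _ \<theta>])
    show "p_crit 1 2 \<theta> n = (THE p. 0 \<le> p \<and> p \<le> 1 \<and> bprob (torus n 2) p (?line n) = 1 / 2)" for n
      unfolding p_crit_def prob_initial_config Ex_subgraph_1 ..
  qed
  show "(\<lambda>n. p_crit_star0 2 \<theta> n / crit_scale k n) \<longlonglongrightarrow> crit_const \<theta> k"
  proof (rule critical_value_limit[OF k(2), where E = ?dense])
    show "increasing (?dense n)" for n
    proof (rule increasingI)
      fix \<omega> \<omega>' :: "vertex \<Rightarrow> bool"
      assume "?dense n \<omega>" and le: "\<And>v. \<omega> v \<Longrightarrow> \<omega>' v"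
      then obtain v where "v \<in> torus n 2" "\<theta> \<le> open_nbrs n 2 \<omega> v" by blast
      then show "?dense n \<omega>'"
        using open_nbrs_mono[of \<omega> \<omega>' n 2 v, OF le] by (intro bexI[of _ v]) auto
    qed
    show "\<forall>\<^sub>F n in sequentially. \<not> ?dense n (\<lambda>_. False) \<and> ?dense n (\<lambda>v. v \<in> torus n 2)"
      using eventually_ge_at_top[of "\<theta> + 1"]
    proof eventually_elim
      case (elim n)
      let ?v = "crossing 0 1 1"
      have v: "?v \<in> torus n 2" using elim by (intro some_vertex) simp
      have "{w \<in> line n 0 (?v 0) - {?v}. w \<in> torus n 2} = line n 0 1 - {?v}"
        by (auto simp: line_def)
      moreover have "card (line n 0 1 - {?v}) = n - 1"
        using elim crossing_in_lines(1)[of 0 1 n 1] by (subst card_Diff_singleton) (auto simp: card_line)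
      ultimately have "cnt (\<lambda>v. v \<in> torus n 2) (line n 0 (?v 0) - {?v}) = n - 1"
        by (simp only: cnt_def)
      then have "n - 1 \<le> open_nbrs n 2 (\<lambda>v. v \<in> torus n 2) ?v"
        unfolding open_nbrs_2[OF v zero_less_numeral] by linarith
      then have "?dense n (\<lambda>v. v \<in> torus n 2)"
        using elim v by (intro bexI[of _ ?v]) auto
      moreover have "\<not> ?dense n (\<lambda>_. False)"
        using \<theta>0 by (simp add: open_nbrs_def)
      ultimately show ?case by blast
    qed
    show "(\<lambda>n. bprob (torus n 2) (a * crit_scale k n) (?dense n)) \<longlonglongrightarrow> seed_limit \<theta> k a" if "0 < a" for a
      using that k(2) by (rule seed_equivalent_limit) (rule seed_iff(3)[OF _ \<theta>])
    show "p_crit_star0 2 \<theta> n = (THE p. 0 \<le> p \<and> p \<le> 1 \<and> bprob (torus n 2) p (?dense n) = 1 / 2)" for n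
      unfolding p_crit_star0_def prob_initial_config ..
  qed
qed

lemma scale_asymp_equiv:
  assumes "(\<lambda>n. f n / crit_scale k n) \<longlonglongrightarrow> c" "(\<lambda>n. g n / crit_scale k n) \<longlonglongrightarrow> c" "0 < c"
  shows "f \<sim>[sequentially] g"
proof (rule asymp_equivI')
  have "(\<lambda>n. (f n / crit_scale k n) / (g n / crit_scale k n)) \<longlonglongrightarrow> c / c"
    using assms by (intro tendsto_divide) auto
  then have "(\<lambda>n. (f n / crit_scale k n) / (g n / crit_scale k n)) \<longlonglongrightarrow> 1"
    using assms(3) by simp
  then show "(\<lambda>n. f n / g n) \<longlonglongrightarrow> 1"
  proof (rule Lim_transform_eventually)
    show "\<forall>\<^sub>F n in sequentially. (f n / crit_scale k n) / (g n / crit_scale k n) = f n / g n"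
      using eventually_gt_at_top[of 0] by eventually_elim (simp add: crit_scale_def)
  qed
qed

text \<open>
  Taking logarithms to the base \<open>n\<close> turns the constant factor into a vanishing summand of
  the exponent.
\<close>

lemma exponent_of_scale:
  assumes lim: "(\<lambda>n. f n / crit_scale k n) \<longlonglongrightarrow> c" and c: "0 < c"
  shows "\<exists>\<delta>. \<delta> \<longlonglongrightarrow> 2 / real \<theta> - 1 / real k \<and>
    (\<forall>\<^sub>F n in sequentially. f n = real n powr (- 1 - 2 / real \<theta> + \<delta> n))"
proof -
  define \<delta> where "\<delta> n = ln (f n) / ln (real n) + 1 + 2 / real \<theta>" for n
  have pos: "\<forall>\<^sub>F n in sequentially. 0 < f n / crit_scale k n"
    by (rule order_tendstoD(1)[OF lim c])
  have "\<delta> \<longlonglongrightarrow> 2 / real \<theta> - 1 / real k"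
  proof (rule Lim_transform_eventually)
    have "(\<lambda>n. ln (f n / crit_scale k n) / ln (real n)) \<longlonglongrightarrow> 0"
    proof (rule real_tendsto_divide_at_top)
      show "(\<lambda>n. ln (f n / crit_scale k n)) \<longlonglongrightarrow> ln c"
        using lim c by (intro tendsto_ln) auto
      show "filterlim (\<lambda>n. ln (real n)) at_top sequentially" by real_asymp
    qed
    then have "(\<lambda>n. ln (f n / crit_scale k n) / ln (real n) + (2 / real \<theta> - 1 / real k))
        \<longlonglongrightarrow> 0 + (2 / real \<theta> - 1 / real k)"
      by (intro tendsto_add tendsto_const)
    then show "(\<lambda>n. ln (f n / crit_scale k n) / ln (real n) + (2 / real \<theta> - 1 / real k))
        \<longlonglongrightarrow> 2 / real \<theta> - 1 / real k"
      by simp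
    show "\<forall>\<^sub>F n in sequentially. ln (f n / crit_scale k n) / ln (real n) + (2 / real \<theta> - 1 / real k) = \<delta> n"
      using pos eventually_gt_at_top[of 1]
    proof eventually_elim
      case (elim n)
      have s: "0 < crit_scale k n" using elim by (simp add: crit_scale_def)
      then have "0 < f n" using elim by (simp add: zero_less_divide_iff)
      then have "ln (f n / crit_scale k n) = ln (f n) - (- 1 - 1 / real k) * ln (real n)"
        using s elim by (simp add: ln_div crit_scale_def ln_powr)
      moreover have "0 < ln (real n)" using elim by simp
      ultimately show ?case
        by (simp add: \<delta>_def diff_divide_distrib)
    qed
  qed
  moreover have "\<forall>\<^sub>F n in sequentially. f n = real n powr (- 1 - 2 / real \<theta> + \<delta> n)"
    using pos eventually_gt_at_top[of 1]
  proof eventually_elim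
    case (elim n)
    have "0 < crit_scale k n" using elim by (simp add: crit_scale_def)
    then have "0 < f n" using elim by (simp add: zero_less_divide_iff)
    moreover have "0 < ln (real n)" using elim by simp
    ultimately show ?case using elim by (simp add: \<delta>_def powr_def)
  qed
  ultimately show ?thesis by blast
qed

text \<open>
  The difference is 0 for even \<open>\<theta>\<close> and \<open>2 / (\<theta> (\<theta> + 1))\<close> for odd \<open>\<theta>\<close>.
\<close>

lemma exponent_error_bound:
  assumes "k = nat \<lceil>real \<theta> / 2\<rceil>" "0 < \<theta>"
  shows "\<bar>2 / real \<theta> - 1 / real k\<bar> \<le> 2 * real \<theta> powr (- 2)"
  using half_threshold[OF assms(1)]
proof
  assume "\<theta> = 2 * k"
  then show ?thesis by simp
next
  assume \<theta>: "\<theta> = 2 * k - 1 \<and> odd \<theta>"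
  then have "real k = (real \<theta> + 1) / 2" using assms(2) by auto
  moreover have "0 < real \<theta> + real \<theta> * real \<theta>"
    using assms(2) by (intro add_pos_pos mult_pos_pos) auto
  ultimately have "2 / real \<theta> - 1 / real k = 2 / (real \<theta> * (real \<theta> + 1))"
    using assms(2) by (simp add: field_simps)
  moreover have "\<dots> \<le> 2 / (real \<theta> * real \<theta>)"
    using assms(2) by (intro divide_left_mono mult_left_mono) auto
  ultimately show ?thesis
    using assms(2) by (simp add: powr_minus powr_numeral power2_eq_square divide_inverse)
qed

lemma exponent_error_small:
  "(\<lambda>\<theta>. 2 / real \<theta> - 1 / real (nat \<lceil>real \<theta> / 2\<rceil>)) \<in> o[at_top](\<lambda>\<theta>. real \<theta> powr (- 3 / 2))"
proof (rule landau_o.big_small_trans)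
  show "(\<lambda>\<theta>. 2 / real \<theta> - 1 / real (nat \<lceil>real \<theta> / 2\<rceil>)) \<in> O[at_top](\<lambda>\<theta>. real \<theta> powr (- 2))"
  proof (rule bigoI[where c = 2])
    show "\<forall>\<^sub>F \<theta> in at_top. norm (2 / real \<theta> - 1 / real (nat \<lceil>real \<theta> / 2\<rceil>)) \<le> 2 * norm (real \<theta> powr - 2)"
      using eventually_gt_at_top[of 0]
      by eventually_elim (use exponent_error_bound in simp)
  qed
  show "(\<lambda>\<theta>::nat. real \<theta> powr (- 2)) \<in> o[at_top](\<lambda>\<theta>. real \<theta> powr (- 3 / 2))"
    by real_asymp
qed

theorem theorem2p1:
  shows
    "(\<forall>(\<theta>::nat) (k::nat) (a::real). k = nat \<lceil>real \<theta> / 2\<rceil> \<and> k > 1 \<and> a > 0 \<longrightarrow>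
        (\<lambda>n. measure_pmf.prob (initial_config n 2 (a * real n powr (- 1 - 1 / real k)))
               {\<omega>. \<forall>v \<in> torus n 2. bootstrap_limit n 2 \<theta> \<omega> v})
          \<longlonglongrightarrow> (if odd \<theta> then 1 - exp (- 2 * a ^ k / fact k)
                  else (1 - exp (- (a ^ k) / fact k)) ^ 2))
      \<and>
     (\<forall>\<theta>::nat. nat \<lceil>real \<theta> / 2\<rceil> > 1 \<longrightarrow>
        p_crit 2 2 \<theta> \<sim>[sequentially] p_crit 1 2 \<theta> \<and>
        p_crit 1 2 \<theta> \<sim>[sequentially] p_crit_star0 2 \<theta>) \<and>
     (\<exists>e :: nat \<Rightarrow> real. e \<in> o[at_top](\<lambda>\<theta>. real \<theta> powr (- 3 / 2)) \<and>
        (\<forall>\<theta>::nat. nat \<lceil>real \<theta> / 2\<rceil> > 1 \<longrightarrow>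
          (\<forall>pc \<in> {p_crit 2 2 \<theta>, p_crit 1 2 \<theta>, p_crit_star0 2 \<theta>}.
             \<exists>\<delta> :: nat \<Rightarrow> real. \<delta> \<longlonglongrightarrow> e \<theta> \<and>
               (\<forall>\<^sub>F n in sequentially. pc n = real n powr (- 1 - 2 / real \<theta> + \<delta> n)))))
      \<and>
     (\<forall>(\<theta>::nat) (k::nat) (a::real). k = nat \<lceil>real \<theta> / 2\<rceil> \<and> k > 1 \<and> a > 0 \<longrightarrow>
        (\<lambda>n. measure_pmf.prob (initial_config n 2 (a * real n powr (- 1 - 1 / real k)))
               ({\<omega>. \<exists>v \<in> torus n 2. bootstrap_limit n 2 \<theta> \<omega> v \<noteq> \<omega> v} -
                {\<omega>. \<forall>v \<in> torus n 2. bootstrap_limit n 2 \<theta> \<omega> v}))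
          \<longlonglongrightarrow> 0)"
proof (intro conjI allI impI exI[of _ "\<lambda>\<theta>. 2 / real \<theta> - 1 / real (nat \<lceil>real \<theta> / 2\<rceil>)"])
  fix \<theta> k :: nat and a :: real
  assume "k = nat \<lceil>real \<theta> / 2\<rceil> \<and> k > 1 \<and> a > 0"
  then have k: "k = nat \<lceil>real \<theta> / 2\<rceil>" "1 < k" and a: "0 < a" by auto
  show "(\<lambda>n. measure_pmf.prob (initial_config n 2 (a * real n powr (- 1 - 1 / real k)))
             {\<omega>. \<forall>v \<in> torus n 2. bootstrap_limit n 2 \<theta> \<omega> v})
          \<longlonglongrightarrow> (if odd \<theta> then 1 - exp (- 2 * a ^ k / fact k)
                  else (1 - exp (- (a ^ k) / fact k)) ^ 2)"
    unfolding prob_initial_config crit_scale_def[symmetric] seed_limit_def[symmetric]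
    using a k(2) by (rule seed_equivalent_limit) (rule seed_iff(1)[OF _ half_threshold[OF k(1)]])
  let ?P = "\<lambda>n. bprob (torus n 2) (a * crit_scale k n)"
  have "(\<lambda>n. ?P n (\<lambda>\<omega>. (\<exists>v \<in> torus n 2. bootstrap_limit n 2 \<theta> \<omega> v \<noteq> \<omega> v)
      \<and> \<not> (\<forall>v \<in> torus n 2. bootstrap_limit n 2 \<theta> \<omega> v))) \<longlonglongrightarrow> 0"
  proof (rule tendsto_sandwich[OF _ _ tendsto_const not_typical_limit[OF a k(2), of "\<theta> + k"]])
    show "\<forall>\<^sub>F n in sequentially. ?P n (\<lambda>\<omega>. (\<exists>v \<in> torus n 2. bootstrap_limit n 2 \<theta> \<omega> v \<noteq> \<omega> v)
      \<and> \<not> (\<forall>v \<in> torus n 2. bootstrap_limit n 2 \<theta> \<omega> v)) \<le> ?P n (\<lambda>\<omega>. \<not> typical n k (\<theta> + k) \<omega>)"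
      using eventually_gt_at_top[of k]
    proof eventually_elim
      case (elim n)
      show ?case
      proof (rule bprob_mono, rule notI)
        fix \<omega> assume *: "(\<exists>v \<in> torus n 2. bootstrap_limit n 2 \<theta> \<omega> v \<noteq> \<omega> v)
          \<and> \<not> (\<forall>v \<in> torus n 2. bootstrap_limit n 2 \<theta> \<omega> v)" and typical: "typical n k (\<theta> + k) \<omega>"
        then have "\<not> seed n \<theta> k \<omega>"
          using seed_iff(1)[OF typical half_threshold[OF k(1)] elim] by blast
        then have "bootstrap_limit n 2 \<theta> \<omega> = \<omega>"
          by (rule not_seed_stuck[OF typical half_threshold[OF k(1)]])
        with * show False by simp
      qed
    qed
  qed simp
  then show "(\<lambda>n. measure_pmf.prob (initial_config n 2 (a * real n powr (- 1 - 1 / real k)))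
               ({\<omega>. \<exists>v \<in> torus n 2. bootstrap_limit n 2 \<theta> \<omega> v \<noteq> \<omega> v} -
                {\<omega>. \<forall>v \<in> torus n 2. bootstrap_limit n 2 \<theta> \<omega> v})) \<longlonglongrightarrow> 0"
    unfolding set_diff_eq mem_Collect_eq prob_initial_config crit_scale_def[symmetric] .
next
  fix \<theta> :: nat assume "nat \<lceil>real \<theta> / 2\<rceil> > 1"
  note lims = critical_values_limit[OF refl this]
  have "0 < crit_const \<theta> (nat \<lceil>real \<theta> / 2\<rceil>)"
    using \<open>nat \<lceil>real \<theta> / 2\<rceil> > 1\<close> by (intro crit_const_pos) simp
  then show "p_crit 2 2 \<theta> \<sim>[sequentially] p_crit 1 2 \<theta>" "p_crit 1 2 \<theta> \<sim>[sequentially] p_crit_star0 2 \<theta>"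
    using lims by (blast intro: scale_asymp_equiv)+
next
  show "(\<lambda>\<theta>. 2 / real \<theta> - 1 / real (nat \<lceil>real \<theta> / 2\<rceil>)) \<in> o[at_top](\<lambda>\<theta>. real \<theta> powr (- 3 / 2))"
    by (rule exponent_error_small)
next
  fix \<theta> :: nat assume big: "nat \<lceil>real \<theta> / 2\<rceil> > 1"
  then have pos: "0 < crit_const \<theta> (nat \<lceil>real \<theta> / 2\<rceil>)" by (intro crit_const_pos) simp
  note lims = critical_values_limit[OF refl big]
  show "\<forall>pc \<in> {p_crit 2 2 \<theta>, p_crit 1 2 \<theta>, p_crit_star0 2 \<theta>}.
             \<exists>\<delta> :: nat \<Rightarrow> real. \<delta> \<longlonglongrightarrow> 2 / real \<theta> - 1 / real (nat \<lceil>real \<theta> / 2\<rceil>) \<and>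
               (\<forall>\<^sub>F n in sequentially. pc n = real n powr (- 1 - 2 / real \<theta> + \<delta> n))"
    using lims[THEN exponent_of_scale, OF pos] by simp
qed

end
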